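(* Let $T_k$ be a random binary search tree with $k$ leaves and let $A_k=|\mathrm{Aut}(T_k)|$ be the cardinality of its automorphism group. Then $\log_2 A_k$ satisfies a central limit theorem: there are positive constants $\nu$ and $\sigma_3$ such that for every real $x$, $$\mathbb{P}\big(A_k\le 2^{\nu k+\sigma_3\sqrt{k}\,x}\big)\xrightarrow{k\to\infty}\frac{1}{\sqrt{2\pi}}\int_{-\infty}^x e^{-t^2/2}\,dt,$$ where $\nu=\sum_{k\ge1}\frac{P_k^1}{k(2k+1)(2k-1)}\approx 0.3795493473$.
   Context: A binary tree is a rooted tree in which every node has either exactly two children or none; it is ordered if the children of each inner node are ordered. The size $|t|$ of a binary tree $t$ is its number of leaves; $t(v)$ denotes the fringe subtree rooted at node $v$ (the node and all its descendants). A random binary search tree with $k$ leaves is a random ordered binary tree with $k$ leaves distributed according to $P_{\mathrm{bst}}(t)=\prod_{v\in t,\ |t(v)|>1}\frac{1}{|t(v)|-1}$. The automorphism group $\mathrm{Aut}(t)$ of a binary tree $t$ is its automorphism group as an unordered rooted tree; an inner node is symmetrical if the fringe subtrees rooted at its two children are isomorphic as unordered trees, and $|\mathrm{Aut}(t)|=2^{\mathrm{sym}(t)}$ where $\mathrm{sym}(t)$ is the number of symmetrical nodes. $P_k^1$ denotes the probability that two independent random binary search trees with $k$ leaves are isomorphic (equal as unordered trees). *)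

theory Defs
  imports "HOL-Probability.Probability" "HOL-Library.Tree"
begin

text \<open>
  Ordered binary trees are unlabelled library trees; the size of a tree, i.e. its number of
  leaves, is the library function \<^const>\<open>size1\<close> (see \<open>card_leaves\<close> below for the link with nodes).
\<close>

type_synonym btree = "unit tree"

text \<open>
  A node is represented by the path leading to it from the root (\<^const>\<open>False\<close> = left,
  \<^const>\<open>True\<close> = right); in particular the root is \<^term>\<open>[]\<close>.
\<close>

fun nodes :: "btree \<Rightarrow> bool list set" where
  "nodes \<langle>\<rangle> = {[]}"
| "nodes \<langle>l, _, r\<rangle> = insert [] (Cons False ` nodes l \<union> Cons True ` nodes r)"

text \<open>The last equation only concerns paths that are not nodes.\<close>

fun fringe :: "btree \<Rightarrow> bool list \<Rightarrow> btree" where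
  "fringe t [] = t"
| "fringe \<langle>l, _, r\<rangle> (b # v) = fringe (if b then r else l) v"
| "fringe \<langle>\<rangle> (b # v) = \<langle>\<rangle>"

definition P_bst :: "btree \<Rightarrow> real" where
  "P_bst t = (\<Prod>v \<in> {v \<in> nodes t. size1 (fringe t v) > 1}. 1 / (real (size1 (fringe t v)) - 1))"

text \<open>
  The distribution of a random binary search tree with \<open>k\<close> leaves. It is meaningful for
  \<open>k \<ge> 1\<close> only, see \<open>pmf_random_bst\<close>; there is no tree without leaves.
\<close>

definition random_bst :: "nat \<Rightarrow> btree pmf" where
  "random_bst k = embed_pmf (\<lambda>t. if size1 t = k then P_bst t else 0)"

definition is_child :: "bool list \<Rightarrow> bool list \<Rightarrow> bool" where
  "is_child u v \<longleftrightarrow> (\<exists>b. v = u @ [b])"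

text \<open>Isomorphisms of rooted trees, disregarding the order of the children.\<close>

definition rooted_iso :: "(bool list \<Rightarrow> bool list) \<Rightarrow> btree \<Rightarrow> btree \<Rightarrow> bool" where
  "rooted_iso f s t \<longleftrightarrow> bij_betw f (nodes s) (nodes t) \<and> f [] = [] \<and>
     (\<forall>u \<in> nodes s. \<forall>v \<in> nodes s. is_child u v \<longleftrightarrow> is_child (f u) (f v))"

definition isomorphic :: "btree \<Rightarrow> btree \<Rightarrow> bool" where
  "isomorphic s t \<longleftrightarrow> (\<exists>f. rooted_iso f s t)"

text \<open>
  Since \<^const>\<open>permutes\<close> prescribes the values outside \<^term>\<open>nodes t\<close>, every automorphism is counted
  exactly once.
\<close>

definition Aut :: "btree \<Rightarrow> (bool list \<Rightarrow> bool list) set" where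
  "Aut t = {f. f permutes nodes t \<and> rooted_iso f t t}"

definition iso_prob :: "nat \<Rightarrow> real" where
  "iso_prob k = measure_pmf.prob (pair_pmf (random_bst k) (random_bst k)) {(s, t). isomorphic s t}"


lemma finite_nodes [simp]: "finite (nodes t)"
  by (induction t) auto

lemma card_leaves: "card {v \<in> nodes t. fringe t v = \<langle>\<rangle>} = size1 t"
proof (induction t)
  case (Node l x r)
  have "{v \<in> nodes \<langle>l, x, r\<rangle>. fringe \<langle>l, x, r\<rangle> v = \<langle>\<rangle>} =
      Cons False ` {v \<in> nodes l. fringe l v = \<langle>\<rangle>} \<union> Cons True ` {v \<in> nodes r. fringe r v = \<langle>\<rangle>}"
    by auto
  then show ?case
    using Node by (simp only:, subst card_Un_disjoint) (auto simp: card_image)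
next
  case Leaf
  have "{v \<in> nodes \<langle>\<rangle>. fringe \<langle>\<rangle> v = \<langle>\<rangle>} = {[]}" by auto
  then show ?case by simp
qed

lemma size1_pos: "size1 t \<ge> 1"
  by (induction t) auto

lemma P_bst_Leaf: "P_bst \<langle>\<rangle> = 1"
proof -
  have "{v \<in> nodes \<langle>\<rangle>. size1 (fringe \<langle>\<rangle> v) > 1} = {}" by auto
  then show ?thesis by (simp only: P_bst_def prod.empty)
qed

lemma P_bst_Node: "P_bst \<langle>l, x, r\<rangle> = 1 / (real (size1 l + size1 r) - 1) * (P_bst l * P_bst r)"
proof -
  let ?I = "\<lambda>t. {v \<in> nodes t. size1 (fringe t v) > 1}"
  let ?g = "\<lambda>t v. 1 / (real (size1 (fringe t v)) - 1)"
  have I: "?I \<langle>l, x, r\<rangle> = insert [] (Cons False ` ?I l \<union> Cons True ` ?I r)"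
    using size1_pos[of l] size1_pos[of r] by (auto simp del: One_nat_def)
  have "P_bst \<langle>l, x, r\<rangle> = ?g \<langle>l, x, r\<rangle> [] * prod (?g \<langle>l, x, r\<rangle>) (Cons False ` ?I l \<union> Cons True ` ?I r)"
    unfolding P_bst_def I by (subst prod.insert) auto
  also have "prod (?g \<langle>l, x, r\<rangle>) (Cons False ` ?I l \<union> Cons True ` ?I r) =
      prod (?g \<langle>l, x, r\<rangle>) (Cons False ` ?I l) * prod (?g \<langle>l, x, r\<rangle>) (Cons True ` ?I r)"
    by (rule prod.union_disjoint) auto
  also have "\<dots> = P_bst l * P_bst r"
    by (simp add: P_bst_def prod.reindex)
  finally show ?thesis by simp
qed

lemma P_bst_nonneg: "P_bst t \<ge> 0"
  unfolding P_bst_def by (intro prod_nonneg) auto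

lemma trees_rec:
  assumes "k \<ge> 2"
  shows "{t :: btree. size1 t = k} = (\<lambda>(i, l, r). \<langle>l, (), r\<rangle>) `
    (SIGMA i:{1..<k}. {t. size1 t = i} \<times> {t. size1 t = k - i})" (is "?L = ?R")
proof (intro equalityI subsetI)
  fix t assume t: "t \<in> ?L"
  show "t \<in> ?R"
  proof (cases t)
    case (Node l x r)
    have "(size1 l, l, r) \<in> (SIGMA i:{1..<k}. {t. size1 t = i} \<times> {t. size1 t = k - i})"
      using t Node size1_pos[of l] size1_pos[of r] by auto
    then show ?thesis
      using Node by (intro image_eqI[where x = "(size1 l, l, r)"]) auto
  qed (use t assms in auto)
qed auto

lemma trees_1: "{t :: btree. size1 t = 1} = {\<langle>\<rangle>}"
proof -
  have "t = \<langle>\<rangle>" if "size1 t = 1" for t :: btree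
    using that by (simp add: size1_size)
  then show ?thesis by (auto simp del: One_nat_def)
qed

lemma finite_trees: "finite {t :: btree. size1 t = k}"
proof (induction k rule: less_induct)
  case (less k)
  consider "k = 0" | "k = 1" | "k \<ge> 2" by linarith
  then show ?case
  proof cases
    case 1
    have "{t :: btree. size1 t = 0} = {}"
      by (auto simp: size1_size)
    with 1 show ?thesis by (simp only: finite.emptyI)
  next
    case 2
    then show ?thesis by (simp only: trees_1) simp
  next
    case 3
    then show ?thesis
      using less by (subst trees_rec) (auto intro!: finite_imageI finite_SigmaI)
  qed
qed

lemma sum_P_bst:
  assumes "k \<ge> 1"
  shows "(\<Sum>t | size1 t = k. P_bst t) = 1"
  using assms
proof (induction k rule: less_induct)
  case (less k)
  show ?case
  proof (cases "k = 1")
    case True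
    then show ?thesis by (simp only: trees_1) (simp add: P_bst_Leaf)
  next
    case False
    with less.prems have k: "k \<ge> 2" by simp
    let ?T = "\<lambda>i. {t :: btree. size1 t = i}"
    have "(\<Sum>t\<in>?T k. P_bst t) = (\<Sum>(i, l, r)\<in>(SIGMA i:{1..<k}. ?T i \<times> ?T (k - i)). P_bst \<langle>l, (), r\<rangle>)"
      unfolding trees_rec[OF k] by (subst sum.reindex) (auto simp: inj_on_def case_prod_unfold)
    also have "\<dots> = (\<Sum>i\<in>{1..<k}. \<Sum>(l, r)\<in>?T i \<times> ?T (k - i). P_bst \<langle>l, (), r\<rangle>)"
      by (rule sum.Sigma[symmetric]) (auto intro: finite_trees)
    also have "\<dots> = (\<Sum>i\<in>{1..<k}. 1 / (real k - 1))"
    proof (rule sum.cong)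
      fix i assume i: "i \<in> {1..<k}"
      have "(\<Sum>(l, r)\<in>?T i \<times> ?T (k - i). P_bst \<langle>l, (), r\<rangle>) =
          (\<Sum>(l, r)\<in>?T i \<times> ?T (k - i). 1 / (real k - 1) * (P_bst l * P_bst r))"
        using i by (intro sum.cong) (auto simp: P_bst_Node of_nat_diff)
      also have "\<dots> = 1 / (real k - 1) * ((\<Sum>l\<in>?T i. P_bst l) * (\<Sum>r\<in>?T (k - i). P_bst r))"
        unfolding sum_product sum.cartesian_product by (simp add: sum_distrib_left case_prod_unfold)
      also have "\<dots> = 1 / (real k - 1)"
        using less.IH[of i] less.IH[of "k - i"] i by (simp add: Suc_le_eq)
      finally show "(\<Sum>(l, r)\<in>?T i \<times> ?T (k - i). P_bst \<langle>l, (), r\<rangle>) = 1 / (real k - 1)" .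
    qed simp
    also have "\<dots> = 1"
      using k by (simp add: of_nat_diff)
    finally show ?thesis .
  qed
qed

lemma pmf_random_bst:
  assumes "k \<ge> 1"
  shows "pmf (random_bst k) t = (if size1 t = k then P_bst t else 0)"
  unfolding random_bst_def
proof (rule pmf_embed_pmf)
  let ?f = "\<lambda>t. if size1 t = k then P_bst t else 0"
  have "(\<integral>\<^sup>+t. ennreal (?f t) \<partial>count_space UNIV) = (\<Sum>t | size1 t = k. ennreal (?f t))"
    by (rule nn_integral_count_space'[OF finite_trees]) auto
  also have "\<dots> = ennreal (\<Sum>t | size1 t = k. P_bst t)"
    by (subst sum_ennreal[symmetric]) (auto simp: P_bst_nonneg)
  finally show "(\<integral>\<^sup>+t. ennreal (?f t) \<partial>count_space UNIV) = 1"
    by (simp only: sum_P_bst[OF assms] ennreal_1)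
qed (simp add: P_bst_nonneg)

end

theory Submission
  imports Defs
begin

text \<open>
  Since \<open>|Aut t| = 2^sym t\<close>, the claim is a central limit theorem for the number \<open>sym\<close> of symmetrical
  nodes. This is an additive functional: it is the sum over both subtrees of the root plus a toll in
  \<open>{0, 1}\<close> whose expectation \<open>P_k^1 / (2 k - 1)\<close> for trees of size \<open>2 k\<close> is exponentially small. A
  recurrence \<open>x n = 2 / (n - 1) * (\<Sum>i=1..<n. x i) + \<rho> n\<close> with exponentially small \<open>\<rho>\<close> has the solution
  \<open>L n\<close> up to an exponentially small error, where \<open>L = (\<Sum>m. 2 \<rho> m / (m (m + 1)))\<close>. For the mean this
  gives \<open>L = \<nu>\<close>; for the second moment of \<open>X = sym - \<nu> size\<close> it gives a rate \<open>\<sigma>\<^sup>2\<close>. The rate is positive,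
  for otherwise the second moment would be exponentially small, whereas a subtree of size 4 at the root
  alone contributes at least a constant times \<open>1/n\<close>.

  The characteristic function \<open>\<phi>\<^sub>n(t)\<close> of \<open>X\<close> satisfies, up to the toll, \<open>\<phi>\<^sub>n = 1 / (n - 1) * (\<Sum>i=1..<n. \<phi>\<^sub>i \<phi>\<^sub>n\<^sub>-\<^sub>i)\<close>,
  and so does that of a normal variable with the same mean and variance; the toll terms agree up to
  \<open>O(t\<^sup>3)\<close>, uniformly in \<open>n\<close>. Hence both functions differ by \<open>O(n t\<^sup>3)\<close>, which vanishes for
  \<open>t = s / (\<sigma> sqrt n)\<close>, and Levy's continuity theorem applies.

  The value of \<open>\<nu>\<close> comes from the exact values of \<open>P_k^1\<close> for \<open>k \<le> 25\<close> and a geometric bound on the rest.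
\<close>

section \<open>Automorphisms and symmetrical nodes\<close>

lemma Nil_in_nodes [simp]: "[] \<in> nodes t"
  by (cases t) auto

lemma Cons_in_nodes_Node [simp]: "c # v \<in> nodes \<langle>l, x, r\<rangle> \<longleftrightarrow> v \<in> nodes (if c then r else l)"
  by auto

declare nodes.simps(2) [simp del]

lemma nodes_prefix: "u @ v \<in> nodes t \<Longrightarrow> u \<in> nodes t"
proof (induction u arbitrary: t)
  case (Cons c u)
  then show ?case by (cases t) (auto split: if_splits)
qed simp

text \<open>Extensionality makes every isomorphism count exactly once.\<close>

definition isos :: "btree \<Rightarrow> btree \<Rightarrow> (bool list \<Rightarrow> bool list) set" where
  "isos s t = {f \<in> extensional (nodes s). rooted_iso f s t}"

lemma finite_isos [simp]: "finite (isos s t)"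
proof (rule finite_subset)
  show "isos s t \<subseteq> nodes s \<rightarrow>\<^sub>E nodes t"
    by (auto simp: isos_def rooted_iso_def PiE_def bij_betw_def)
qed (simp add: finite_PiE)

lemma rooted_iso_cong:
  assumes "\<And>v. v \<in> nodes s \<Longrightarrow> f v = g v"
  shows "rooted_iso f s t \<longleftrightarrow> rooted_iso g s t"
  using assms by (auto simp: rooted_iso_def cong: bij_betw_cong)

lemma rooted_isoD:
  assumes "rooted_iso f s t"
  shows "bij_betw f (nodes s) (nodes t)" "f [] = []"
    "u \<in> nodes s \<Longrightarrow> v \<in> nodes s \<Longrightarrow> is_child u v \<longleftrightarrow> is_child (f u) (f v)"
  using assms by (simp_all add: rooted_iso_def)

text \<open>Restriction to the nodes and extension by the identity are inverse to each other, so
  fixing the values off the tree by \<open>permutes\<close> or by \<open>extensional\<close> gives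
  the same count.\<close>

lemma card_Aut: "card (Aut t) = card (isos t t)"
proof (rule bij_betw_same_card)
  let ?I = "\<lambda>f v. if v \<in> nodes t then f v else v"
  show "bij_betw (\<lambda>f. restrict f (nodes t)) (Aut t) (isos t t)"
  proof (rule bij_betw_byWitness[where f' = ?I])
    show "\<forall>f\<in>Aut t. ?I (restrict f (nodes t)) = f"
      by (auto simp: Aut_def permutes_def fun_eq_iff)
    show "\<forall>f\<in>isos t t. restrict (?I f) (nodes t) = f"
      by (auto simp: isos_def extensional_def fun_eq_iff)
    show "(\<lambda>f. restrict f (nodes t)) ` Aut t \<subseteq> isos t t"
      using rooted_iso_cong[of t "restrict f (nodes t)" f t for f] by (auto simp: Aut_def isos_def)
    show "?I ` isos t t \<subseteq> Aut t"
    proof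
      fix g assume "g \<in> ?I ` isos t t"
      then obtain f where f: "rooted_iso f t t" and g: "g = ?I f" by (auto simp: isos_def)
      have iso: "rooted_iso g t t" using f g rooted_iso_cong[of t g f t] by simp
      have "g permutes nodes t"
        using iso by (intro bij_imp_permutes) (auto simp: rooted_iso_def g)
      then show "g \<in> Aut t" using iso by (simp add: Aut_def)
    qed
  qed
qed

lemma isomorphic_iff_isos: "isomorphic s t \<longleftrightarrow> isos s t \<noteq> {}"
proof
  assume "isomorphic s t"
  then obtain f where f: "rooted_iso f s t" by (auto simp: isomorphic_def)
  then have "restrict f (nodes s) \<in> isos s t"
    using rooted_iso_cong[of s "restrict f (nodes s)" f t] by (auto simp: isos_def)
  then show "isos s t \<noteq> {}" by auto
qed (auto simp: isos_def isomorphic_def)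

text \<open>The flag \<open>b\<close> tells whether the left subtree is mapped to the right one.\<close>

definition glue :: "btree \<Rightarrow> btree \<Rightarrow> bool \<Rightarrow> (bool list \<Rightarrow> bool list) \<times> (bool list \<Rightarrow> bool list) \<Rightarrow> bool list \<Rightarrow> bool list"
  where "glue l r b p = restrict (\<lambda>u. case u of [] \<Rightarrow> [] | c # v \<Rightarrow> (c \<noteq> b) # (if c then snd p v else fst p v)) (nodes \<langle>l, (), r\<rangle>)"

lemma is_child_Nil [simp]: "is_child [] v \<longleftrightarrow> (\<exists>c. v = [c])" "\<not> is_child u []"
  by (auto simp: is_child_def)

lemma is_child_Cons [simp]: "is_child (c # u) (d # v) \<longleftrightarrow> c = d \<and> is_child u v"
  by (auto simp: is_child_def)

text \<open>The two children of the root are mapped to the two children of the root, and every other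
  node stays below the image of its parent; hence the first step of a path is merely xor-ed with the
  flag \<open>b\<close>.\<close>

lemma rooted_iso_NodeD:
  assumes iso: "rooted_iso f \<langle>l, x, r\<rangle> \<langle>l', y, r'\<rangle>" and b: "f [False] = [b]"
    and v: "v \<in> nodes (if c then r else l)"
  obtains w where "f (c # v) = (c \<noteq> b) # w" "w \<in> nodes (if c \<noteq> b then r' else l')"
proof -
  let ?s = "\<langle>l, x, r\<rangle>" and ?t = "\<langle>l', y, r'\<rangle>"
  have bij: "bij_betw f (nodes ?s) (nodes ?t)" and nil: "f [] = []"
    and ch: "\<And>u v. u \<in> nodes ?s \<Longrightarrow> v \<in> nodes ?s \<Longrightarrow> is_child u v \<longleftrightarrow> is_child (f u) (f v)"
    using rooted_isoD[OF iso] by blast+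
  have inj: "inj_on f (nodes ?s)" using bij by (simp add: bij_betw_def)
  have "is_child (f []) (f [True])" by (subst ch[symmetric]) auto
  then obtain d where d: "f [True] = [d]" by (auto simp: nil)
  have "d \<noteq> b" using inj_onD[OF inj, of "[True]" "[False]"] b d by auto
  then have c1: "f [c] = [c \<noteq> b]" using b d by (cases c) auto
  \<comment> \<open>A child path extends its parent at the end, hence the reverse induction.\<close>
  have "\<exists>w. f (c # v) = (c \<noteq> b) # w" using v
  proof (induction v rule: rev_induct)
    case (snoc a v)
    then have v: "v \<in> nodes (if c then r else l)" using nodes_prefix by blast
    then obtain w where w: "f (c # v) = (c \<noteq> b) # w" using snoc.IH by blast
    have "is_child (f (c # v)) (f (c # v @ [a]))"
      using v snoc.prems by (subst ch[symmetric]) (auto simp: is_child_def)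
    then show ?case by (auto simp: w is_child_def)
  qed (use c1 in auto)
  then obtain w where w: "f (c # v) = (c \<noteq> b) # w" by blast
  have "f (c # v) \<in> nodes ?t" using bij v by (auto simp: bij_betw_def)
  then show ?thesis using that[OF w] w by auto
qed

lemma rooted_iso_subtree:
  assumes iso: "rooted_iso f \<langle>l, x, r\<rangle> \<langle>l', y, r'\<rangle>" and b: "f [False] = [b]"
  shows "rooted_iso (\<lambda>v. tl (f (c # v))) (if c then r else l) (if c \<noteq> b then r' else l')"
proof -
  let ?s = "\<langle>l, x, r\<rangle>" and ?t = "\<langle>l', y, r'\<rangle>"
  let ?s' = "if c then r else l" and ?t' = "if c \<noteq> b then r' else l'"
  have bij: "bij_betw f (nodes ?s) (nodes ?t)" and nil: "f [] = []"
    and ch: "\<And>u v. u \<in> nodes ?s \<Longrightarrow> v \<in> nodes ?s \<Longrightarrow> is_child u v \<longleftrightarrow> is_child (f u) (f v)"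
    using rooted_isoD[OF iso] by blast+
  have inj: "inj_on f (nodes ?s)" and surj: "f ` nodes ?s = nodes ?t"
    using bij by (simp_all add: bij_betw_def)
  have f: "f (a # v) = (a \<noteq> b) # tl (f (a # v)) \<and> tl (f (a # v)) \<in> nodes (if a \<noteq> b then r' else l')"
    if "v \<in> nodes (if a then r else l)" for a v
    using rooted_iso_NodeD[OF iso b that] by (metis list.sel(3))
  have "bij_betw (\<lambda>v. tl (f (c # v))) (nodes ?s') (nodes ?t')"
    unfolding bij_betw_def
  proof
    show "inj_on (\<lambda>v. tl (f (c # v))) (nodes ?s')"
    proof (rule inj_onI)
      fix u v assume uv: "u \<in> nodes ?s'" "v \<in> nodes ?s'" and eq: "tl (f (c # u)) = tl (f (c # v))"
      have "f (c # u) = f (c # v)" using f[OF uv(1)] f[OF uv(2)] eq by metis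
      moreover have "c # u \<in> nodes ?s" "c # v \<in> nodes ?s" using uv by simp_all
      ultimately have "c # u = c # v"
        using inj_onD[OF inj] by blast
      then show "u = v" by simp
    qed
    show "(\<lambda>v. tl (f (c # v))) ` nodes ?s' = nodes ?t'"
    proof (intro equalityI subsetI)
      fix w assume "w \<in> nodes ?t'"
      then have "(c \<noteq> b) # w \<in> f ` nodes ?s" unfolding surj by simp
      then obtain p where p: "p \<in> nodes ?s" "f p = (c \<noteq> b) # w" by force
      then obtain a v where av: "p = a # v" using nil by (cases p) auto
      then have v: "v \<in> nodes (if a then r else l)" using p by simp
      \<comment> \<open>Xor with \<open>b\<close> is injective, so the preimage of a path from
        \<open>?t'\<close> starts with \<open>c\<close>, that is, it comes from
        \<open>?s'\<close>.\<close>
      have "(a \<noteq> b) = (c \<noteq> b)" using f[OF v] p(2) av by (metis list.sel(1))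
      then have "a = c" by auto
      then show "w \<in> (\<lambda>v. tl (f (c # v))) ` nodes ?s'" using v p(2) av by (intro image_eqI[of _ _ v]) auto
    next
      fix w assume "w \<in> (\<lambda>v. tl (f (c # v))) ` nodes ?s'"
      then show "w \<in> nodes ?t'" using f[of _ c] by blast
    qed
  qed
  moreover have "tl (f [c]) = []"
  proof -
    have "is_child (f []) (f [c])" by (subst ch[symmetric]) auto
    then show ?thesis by (auto simp: nil)
  qed
  moreover have "is_child u v \<longleftrightarrow> is_child (tl (f (c # u))) (tl (f (c # v)))"
    if "u \<in> nodes ?s'" "v \<in> nodes ?s'" for u v
  proof -
    have "is_child u v \<longleftrightarrow> is_child (f (c # u)) (f (c # v))"
      using that by (subst ch[symmetric]) simp_all
    also have "\<dots> \<longleftrightarrow> is_child (tl (f (c # u))) (tl (f (c # v)))"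
      using f[OF that(1)] f[OF that(2)] by (metis is_child_Cons)
    finally show ?thesis .
  qed
  ultimately show ?thesis by (auto simp: rooted_iso_def)
qed

lemma rooted_iso_glue:
  assumes g: "rooted_iso (fst p) l (if b then r' else l')"
    and h: "rooted_iso (snd p) r (if b then l' else r')"
  shows "rooted_iso (glue l r b p) \<langle>l, x, r\<rangle> \<langle>l', y, r'\<rangle>"
proof -
  let ?s = "\<langle>l, x, r\<rangle>" and ?t = "\<langle>l', y, r'\<rangle>" and ?f = "glue l r b p"
  \<comment> \<open>Indexing the two maps by the first step lets one argument serve both subtrees
    and both values of the flag.\<close>
  define k where "k c = (if c then snd p else fst p)" for c
  have k: "bij_betw (k c) (nodes (if c then r else l)) (nodes (if c \<noteq> b then r' else l'))" "k c [] = []"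
    and kch: "\<And>u v. u \<in> nodes (if c then r else l) \<Longrightarrow> v \<in> nodes (if c then r else l) \<Longrightarrow>
       is_child u v \<longleftrightarrow> is_child (k c u) (k c v)" for c
    using g h by (cases c; cases b; simp add: k_def rooted_iso_def)+
  have f: "?f [] = []" "\<And>c v. v \<in> nodes (if c then r else l) \<Longrightarrow> ?f (c # v) = (c \<noteq> b) # k c v"
    by (auto simp: glue_def k_def)
  have "bij_betw ?f (nodes ?s) (nodes ?t)"
    unfolding bij_betw_def
  proof
    show "inj_on ?f (nodes ?s)"
    proof (rule inj_onI)
      fix u v assume uv: "u \<in> nodes ?s" "v \<in> nodes ?s" "?f u = ?f v"
      show "u = v"
      proof (cases u)
        case Nil
        then show ?thesis using uv f by (cases v) auto
      next
        case (Cons c u')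
        then obtain d v' where v: "v = d # v'" using uv f by (cases v) auto
        have "(c \<noteq> b) # k c u' = (d \<noteq> b) # k d v'"
          using uv f(2)[of u' c] f(2)[of v' d] unfolding Cons v Cons_in_nodes_Node by simp
        then have cd: "c = d" and "k c u' = k d v'" by blast+
        then have eq: "k c u' = k c v'" by simp
        have "u' \<in> nodes (if c then r else l)" "v' \<in> nodes (if c then r else l)"
          using uv(1,2) unfolding Cons v Cons_in_nodes_Node cd by simp_all
        with eq have "u' = v'"
          using bij_betw_imp_inj_on[OF k(1)[of c]] by (simp add: inj_on_def)
        then show ?thesis using Cons v cd by simp
      qed
    qed
    show "?f ` nodes ?s = nodes ?t"
    proof (intro equalityI subsetI)
      fix w assume "w \<in> ?f ` nodes ?s"
      then obtain u where u: "u \<in> nodes ?s" "w = ?f u" by auto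
      show "w \<in> nodes ?t"
      proof (cases u)
        case (Cons c v)
        then have v: "v \<in> nodes (if c then r else l)" using u(1) unfolding Cons_in_nodes_Node by simp
        then have "k c v \<in> nodes (if c \<noteq> b then r' else l')" using k(1)[of c] by (blast dest: bij_betwE)
        then show ?thesis unfolding u(2) Cons f(2)[OF v] Cons_in_nodes_Node .
      qed (simp add: u f)
    next
      fix w assume w: "w \<in> nodes ?t"
      show "w \<in> ?f ` nodes ?s"
      proof (cases w)
        case Nil
        then show ?thesis using f(1) by (intro image_eqI[of _ _ "[]"]) simp_all
      next
        case (Cons d w')
        define c where "c = (d \<noteq> b)"
        have d: "d = (c \<noteq> b)" by (auto simp: c_def)
        have "w' \<in> nodes (if c \<noteq> b then r' else l')" using w unfolding Cons d Cons_in_nodes_Node .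
        then obtain v where v: "v \<in> nodes (if c then r else l)" "w' = k c v"
          using k(1)[of c] unfolding bij_betw_def by blast
        then show ?thesis using f(2)[OF v(1)] Cons d
          by (intro image_eqI[of _ _ "c # v"]) (simp_all only: Cons_in_nodes_Node)
      qed
    qed
  qed
  moreover have "is_child u v \<longleftrightarrow> is_child (?f u) (?f v)" if uv: "u \<in> nodes ?s" "v \<in> nodes ?s" for u v
  proof (cases v)
    case (Cons d v')
    then have v': "v' \<in> nodes (if d then r else l)" using uv by (simp only: Cons_in_nodes_Node)
    show ?thesis
    proof (cases u)
      case Nil
      \<comment> \<open>Children of the root are the paths of length one, so only the root of a
        subtree may be mapped to the root of a subtree.\<close>
      have "v' = [] \<longleftrightarrow> k d v' = []"
        using inj_onD[OF bij_betw_imp_inj_on[OF k(1)[of d]], of v' "[]"] v' k(2)[of d] by auto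
      then show ?thesis by (simp add: Nil f Cons v')
    next
      case u: (Cons c u')
      then have u': "u' \<in> nodes (if c then r else l)" using uv by (simp only: Cons_in_nodes_Node)
      show ?thesis
        unfolding u Cons f(2)[OF u'] f(2)[OF v'] is_child_Cons
        using kch[of u' c v'] u' v' by (cases "c = d") auto
    qed
  qed (simp add: f)
  ultimately show ?thesis by (simp add: rooted_iso_def f)
qed

text \<open>Given the flag, an isomorphism amounts to one isomorphism per subtree:
  \<open>rooted_iso_glue\<close> and \<open>rooted_iso_subtree\<close> are the two directions, and
  the restrictions in the witness restore extensionality.\<close>

lemma bij_betw_glue:
  "bij_betw (glue l r b) (isos l (if b then r' else l') \<times> isos r (if b then l' else r'))
     {f \<in> isos \<langle>l, x, r\<rangle> \<langle>l', y, r'\<rangle>. f [False] = [b]}" (is "bij_betw _ ?A ?B")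
proof (rule bij_betw_byWitness[where
      f' = "\<lambda>f. (\<lambda>v\<in>nodes l. tl (f (False # v)), \<lambda>v\<in>nodes r. tl (f (True # v)))"])
  show "\<forall>p\<in>?A. (\<lambda>v\<in>nodes l. tl (glue l r b p (False # v)), \<lambda>v\<in>nodes r. tl (glue l r b p (True # v))) = p"
    by (auto simp: isos_def glue_def fun_eq_iff extensional_def)
  show "\<forall>f\<in>?B. glue l r b (\<lambda>v\<in>nodes l. tl (f (False # v)), \<lambda>v\<in>nodes r. tl (f (True # v))) = f"
  proof (intro ballI ext)
    fix f u assume f: "f \<in> ?B"
    then have iso: "rooted_iso f \<langle>l, x, r\<rangle> \<langle>l', y, r'\<rangle>" and b: "f [False] = [b]"
      and ext: "f \<in> extensional (nodes \<langle>l, x, r\<rangle>)"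
      by (auto simp: isos_def)
    show "glue l r b (\<lambda>v\<in>nodes l. tl (f (False # v)), \<lambda>v\<in>nodes r. tl (f (True # v))) u = f u"
    proof (cases "u \<in> nodes \<langle>l, x, r\<rangle>")
      case False
      then show ?thesis using ext by (auto simp: glue_def extensional_def)
    next
      case True
      show ?thesis
      proof (cases u)
        case Nil
        then show ?thesis using iso by (simp add: glue_def rooted_iso_def)
      next
        case (Cons c v)
        then have v: "v \<in> nodes (if c then r else l)" using True by (simp only: Cons_in_nodes_Node)
        obtain w where "f (c # v) = (c \<noteq> b) # w"
          using rooted_iso_NodeD[OF iso b v] by blast
        then show ?thesis using v Cons by (cases c) (auto simp: glue_def)
      qed
    qed
  qed
  show "glue l r b ` ?A \<subseteq> ?B"
  proof
    fix f assume "f \<in> glue l r b ` ?A"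
    then obtain p where p: "p \<in> ?A" "f = glue l r b p" by blast
    then have "rooted_iso f \<langle>l, x, r\<rangle> \<langle>l', y, r'\<rangle>"
      using rooted_iso_glue[of p l b r' l' r x y] by (auto simp: isos_def)
    moreover have "f \<in> extensional (nodes \<langle>l, x, r\<rangle>)" by (auto simp: p glue_def extensional_def)
    moreover have "f [False] = [b]" using p by (auto simp: glue_def isos_def rooted_iso_def)
    ultimately show "f \<in> ?B" by (simp add: isos_def)
  qed
  show "(\<lambda>f. (\<lambda>v\<in>nodes l. tl (f (False # v)), \<lambda>v\<in>nodes r. tl (f (True # v)))) ` ?B \<subseteq> ?A"
  proof
    fix p assume "p \<in> (\<lambda>f. (\<lambda>v\<in>nodes l. tl (f (False # v)), \<lambda>v\<in>nodes r. tl (f (True # v)))) ` ?B"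
    then obtain f where f: "f \<in> ?B"
      and p: "p = (\<lambda>v\<in>nodes l. tl (f (False # v)), \<lambda>v\<in>nodes r. tl (f (True # v)))" by blast
    then have iso: "rooted_iso f \<langle>l, x, r\<rangle> \<langle>l', y, r'\<rangle>" and b: "f [False] = [b]"
      by (auto simp: isos_def)
    have "rooted_iso (fst p) l (if b then r' else l')"
      using rooted_iso_subtree[OF iso b, of False]
        rooted_iso_cong[of l "fst p" "\<lambda>v. tl (f (False # v))"] by (simp add: p)
    moreover have "rooted_iso (snd p) r (if b then l' else r')"
      using rooted_iso_subtree[OF iso b, of True]
        rooted_iso_cong[of r "snd p" "\<lambda>v. tl (f (True # v))"] by (simp add: p if_split)
    ultimately show "p \<in> ?A" by (simp add: isos_def mem_Times_iff) (simp add: p)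
  qed
qed

section \<open>Counting isomorphisms and automorphisms\<close>

text \<open>The left child goes either to the left or to the right; each value of the flag
  contributes one product by \<open>bij_betw_glue\<close>.\<close>

lemma card_isos_Node:
  "card (isos \<langle>l, x, r\<rangle> \<langle>l', y, r'\<rangle>) =
     card (isos l l') * card (isos r r') + card (isos l r') * card (isos r l')"
proof -
  let ?I = "isos \<langle>l, x, r\<rangle> \<langle>l', y, r'\<rangle>"
  let ?B = "\<lambda>b. {f \<in> ?I. f [False] = [b]}"
  have "f \<in> ?B False \<union> ?B True" if "f \<in> ?I" for f
  proof -
    have f: "rooted_iso f \<langle>l, x, r\<rangle> \<langle>l', y, r'\<rangle>" using that by (simp add: isos_def)
    have "is_child (f []) (f [False])"
      by (subst rooted_isoD(3)[OF f, symmetric]) (auto simp: is_child_def)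
    then have "is_child [] (f [False])" by (simp only: rooted_isoD(2)[OF f])
    then obtain c where "f [False] = [c]" by auto
    then show ?thesis using that by (cases c) simp_all
  qed
  then have "?I = ?B False \<union> ?B True" by auto
  then have "card ?I = card (?B False \<union> ?B True)" by simp
  also have "\<dots> = card (?B False) + card (?B True)"
    by (rule card_Un_disjoint) auto
  finally show ?thesis
    using bij_betw_same_card[OF bij_betw_glue[of l r False r' l' x y]]
      bij_betw_same_card[OF bij_betw_glue[of l r True r' l' x y]]
    by (simp add: card_cartesian_product)
qed

lemma isos_Leaf_Leaf: "isos \<langle>\<rangle> \<langle>\<rangle> = {\<lambda>v\<in>{[]}. []}"
  by (auto simp: isos_def rooted_iso_def fun_eq_iff extensional_def)

lemma isos_Leaf_Node: "isos \<langle>\<rangle> \<langle>l, x, r\<rangle> = {}"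
proof -
  have False if "rooted_iso f \<langle>\<rangle> \<langle>l, x, r\<rangle>" for f
  proof -
    have "f ` {[]} = nodes \<langle>l, x, r\<rangle>" using rooted_isoD(1)[OF that] unfolding bij_betw_def nodes.simps(1) by blast
    moreover have "[False] \<in> nodes \<langle>l, x, r\<rangle>" "[] \<in> nodes \<langle>l, x, r\<rangle>" by auto
    ultimately show False by (metis image_insert image_empty singletonD list.distinct(1))
  qed
  then show ?thesis by (auto simp: isos_def)
qed

lemma isos_Node_Leaf: "isos \<langle>l, x, r\<rangle> \<langle>\<rangle> = {}"
proof -
  have False if "rooted_iso f \<langle>l, x, r\<rangle> \<langle>\<rangle>" for f
  proof -
    have "inj_on f (nodes \<langle>l, x, r\<rangle>)" "f ` nodes \<langle>l, x, r\<rangle> = {[]}"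
      using that by (auto simp: rooted_iso_def bij_betw_def)
    moreover have "[False] \<in> nodes \<langle>l, x, r\<rangle>" "[] \<in> nodes \<langle>l, x, r\<rangle>" by auto
    ultimately show False by (metis imageI inj_onD singletonD list.distinct(1))
  qed
  then show ?thesis by (auto simp: isos_def)
qed

fun nsym :: "btree \<Rightarrow> nat" where
  "nsym \<langle>\<rangle> = 0"
| "nsym \<langle>l, _, r\<rangle> = nsym l + nsym r + (if isomorphic l r then 1 else 0)"

lemma isomorphic_Leaf [simp]:
  "isomorphic \<langle>\<rangle> \<langle>\<rangle>" "\<not> isomorphic \<langle>\<rangle> \<langle>l, x, r\<rangle>" "\<not> isomorphic \<langle>l, x, r\<rangle> \<langle>\<rangle>"
  by (simp_all add: isomorphic_iff_isos isos_Leaf_Leaf isos_Leaf_Node isos_Node_Leaf)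

lemma isomorphic_Node [simp]:
  "isomorphic \<langle>l, x, r\<rangle> \<langle>l', y, r'\<rangle> \<longleftrightarrow>
     isomorphic l l' \<and> isomorphic r r' \<or> isomorphic l r' \<and> isomorphic r l'"
proof -
  have *: "isomorphic s t \<longleftrightarrow> card (isos s t) > 0" for s t
    by (simp add: isomorphic_iff_isos card_gt_0_iff)
  show ?thesis unfolding * card_isos_Node by simp
qed

lemma isomorphic_refl [simp]: "isomorphic t t"
  by (induction t) auto

lemma isomorphic_sym: "isomorphic s t \<Longrightarrow> isomorphic t s"
proof (induction s arbitrary: t)
  case (Node l x r)
  then show ?case by (cases t) auto
next
  case Leaf
  then show ?case by (cases t) auto
qed

lemma isomorphic_trans: "isomorphic s t \<Longrightarrow> isomorphic t u \<Longrightarrow> isomorphic s u"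
proof (induction s arbitrary: t u)
  case (Node l x r)
  then obtain l' x' r' where t: "t = \<langle>l', x', r'\<rangle>" by (cases t) auto
  then obtain l'' x'' r'' where u: "u = \<langle>l'', x'', r''\<rangle>" using Node.prems by (cases u) auto
  show ?case using Node.prems Node.IH unfolding t u isomorphic_Node by blast
next
  case Leaf
  then show ?case by (cases t) auto
qed

lemma isomorphic_size1: "isomorphic s t \<Longrightarrow> size1 s = size1 t"
proof (induction s arbitrary: t)
  case (Node l x r)
  then show ?case by (cases t) fastforce+
next
  case Leaf
  then show ?case by (cases t) auto
qed

text \<open>Isomorphisms between two different trees are counted because the induction pairs
  subtrees of \<open>s\<close> with subtrees of \<open>t\<close>; automorphisms are the case
  \<open>s = t\<close>.\<close>

lemma card_isos: "card (isos s t) = (if isomorphic s t then 2 ^ nsym s else 0)"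
proof (induction s arbitrary: t)
  case (Node l x r)
  show ?case
  proof (cases t)
    case t: (Node l' y r')
    \<comment> \<open>Both summands of \<open>card_isos_Node\<close> are nonzero precisely when the
      trees are isomorphic and the root of \<open>s\<close> is symmetrical; they are then equal,
      which gives the factor 2.\<close>
    have "isomorphic l l' \<and> isomorphic r r' \<and> isomorphic l r' \<and> isomorphic r l' \<longleftrightarrow>
        (isomorphic l l' \<and> isomorphic r r' \<or> isomorphic l r' \<and> isomorphic r l') \<and> isomorphic l r"
      by (meson isomorphic_sym isomorphic_trans)
    then show ?thesis
      by (auto simp: t card_isos_Node Node.IH power_add)
  qed (simp add: isos_Node_Leaf)
next
  case Leaf
  show ?case
    by (cases t) (auto simp: isos_Leaf_Leaf isos_Leaf_Node)
qed

lemma card_Aut_eq: "card (Aut t) = 2 ^ nsym t"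
  by (simp add: card_Aut card_isos)

section \<open>Expectations over random binary search trees\<close>

text \<open>The expectation as a finite sum with values in any real vector space: real moments and
  complex characteristic functions share their lemmas, and integrability is no issue.\<close>

definition bst_mean :: "nat \<Rightarrow> (btree \<Rightarrow> 'a::real_vector) \<Rightarrow> 'a" where
  "bst_mean n g = (\<Sum>t | size1 t = n. P_bst t *\<^sub>R g t)"

lemma bst_mean_cong: "(\<And>t. size1 t = n \<Longrightarrow> f t = g t) \<Longrightarrow> bst_mean n f = bst_mean n g"
  unfolding bst_mean_def by (rule sum.cong) auto

lemma bst_mean_add: "bst_mean n (\<lambda>t. f t + g t) = bst_mean n f + bst_mean n g"
  by (simp add: bst_mean_def scaleR_add_right sum.distrib)

lemma bst_mean_diff: "bst_mean n (\<lambda>t. f t - g t) = bst_mean n f - bst_mean n g"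
  by (simp add: bst_mean_def scaleR_diff_right sum_subtractf)

lemma bst_mean_mult_left:
  "bst_mean n (\<lambda>t. c * f t) = c * bst_mean n (f :: _ \<Rightarrow> 'a :: real_algebra)"
  by (simp add: bst_mean_def sum_distrib_left)

lemma bst_mean_mult_right:
  "bst_mean n (\<lambda>t. f t * c) = bst_mean n (f :: _ \<Rightarrow> 'a :: real_algebra) * c"
  by (simp add: bst_mean_def sum_distrib_right)

lemma bst_mean_divide: "bst_mean n (\<lambda>t. f t / c) = bst_mean n f / (c :: 'a :: real_field)"
  using bst_mean_mult_right[of n f "inverse c"] by (simp add: field_simps)

lemma bst_mean_const: "n \<ge> 1 \<Longrightarrow> bst_mean n (\<lambda>_. c) = c"
  using sum_P_bst[of n] by (simp add: bst_mean_def flip: scaleR_sum_left)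

lemma bst_mean_zero [simp]: "bst_mean n (\<lambda>_. 0) = 0"
  by (simp add: bst_mean_def)

lemma bst_mean_of_real:
  "bst_mean n (\<lambda>t. of_real (f t) :: 'a :: real_algebra_1) = of_real (bst_mean n f)"
  by (simp add: bst_mean_def scaleR_conv_of_real)

lemma bst_mean_mono: "(\<And>t. size1 t = n \<Longrightarrow> f t \<le> g t) \<Longrightarrow> bst_mean n f \<le> bst_mean n (g :: _ \<Rightarrow> real)"
  by (auto simp: bst_mean_def intro!: sum_mono mult_left_mono P_bst_nonneg)

lemma bst_mean_nonneg: "(\<And>t. size1 t = n \<Longrightarrow> 0 \<le> f t) \<Longrightarrow> 0 \<le> bst_mean n (f :: _ \<Rightarrow> real)"
  using bst_mean_mono[of n "\<lambda>_. 0" f] by simp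

lemma norm_bst_mean_le:
  "norm (bst_mean n f) \<le> bst_mean n (\<lambda>t. norm (f t :: 'a :: real_normed_vector))"
  unfolding bst_mean_def by (rule order.trans[OF norm_sum]) (simp add: P_bst_nonneg)

lemma norm_bst_mean_bound:
  assumes "n \<ge> 1" "\<And>t. size1 t = n \<Longrightarrow> norm (f t :: 'a :: real_normed_vector) \<le> c"
  shows "norm (bst_mean n f) \<le> c"
  using norm_bst_mean_le[of n f] bst_mean_mono[of n "\<lambda>t. norm (f t)" "\<lambda>_. c"] bst_mean_const[of n c] assms
  by simp

lemma bst_mean_1: "bst_mean 1 f = f \<langle>\<rangle>"
  unfolding bst_mean_def trees_1 by (simp add: P_bst_Leaf)

text \<open>The left subtree of a random search tree has uniform size in \<open>{1..<n}\<close>, and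
  given the sizes both subtrees are independent random search trees.\<close>

lemma bst_mean_rec:
  assumes n: "n \<ge> 2"
  shows "bst_mean n g =
    (1 / (real n - 1)) *\<^sub>R (\<Sum>i=1..<n. bst_mean i (\<lambda>l. bst_mean (n - i) (\<lambda>r. g \<langle>l, (), r\<rangle>)))"
proof -
  let ?T = "\<lambda>i. {t :: btree. size1 t = i}"
  have "bst_mean n g = (\<Sum>(i, l, r)\<in>(SIGMA i:{1..<n}. ?T i \<times> ?T (n - i)). P_bst \<langle>l, (), r\<rangle> *\<^sub>R g \<langle>l, (), r\<rangle>)"
    unfolding bst_mean_def trees_rec[OF n] by (subst sum.reindex) (auto simp: inj_on_def case_prod_unfold)
  also have "\<dots> = (\<Sum>i\<in>{1..<n}. \<Sum>(l, r)\<in>?T i \<times> ?T (n - i). P_bst \<langle>l, (), r\<rangle> *\<^sub>R g \<langle>l, (), r\<rangle>)"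
    by (rule sum.Sigma[symmetric]) (auto intro: finite_trees)
  also have "\<dots> = (\<Sum>i=1..<n. (1 / (real n - 1)) *\<^sub>R bst_mean i (\<lambda>l. bst_mean (n - i) (\<lambda>r. g \<langle>l, (), r\<rangle>)))"
  proof (rule sum.cong)
    fix i assume i: "i \<in> {1..<n}"
    have "(\<Sum>(l, r)\<in>?T i \<times> ?T (n - i). P_bst \<langle>l, (), r\<rangle> *\<^sub>R g \<langle>l, (), r\<rangle>) =
        (\<Sum>(l, r)\<in>?T i \<times> ?T (n - i). (1 / (real n - 1)) *\<^sub>R P_bst l *\<^sub>R P_bst r *\<^sub>R g \<langle>l, (), r\<rangle>)"
      using i by (intro sum.cong) (auto simp: P_bst_Node of_nat_diff)
    also have "\<dots> = (1 / (real n - 1)) *\<^sub>R bst_mean i (\<lambda>l. bst_mean (n - i) (\<lambda>r. g \<langle>l, (), r\<rangle>))"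
      by (simp add: bst_mean_def scaleR_sum_right sum.cartesian_product case_prod_unfold)
    finally show "(\<Sum>(l, r)\<in>?T i \<times> ?T (n - i). P_bst \<langle>l, (), r\<rangle> *\<^sub>R g \<langle>l, (), r\<rangle>) =
      (1 / (real n - 1)) *\<^sub>R bst_mean i (\<lambda>l. bst_mean (n - i) (\<lambda>r. g \<langle>l, (), r\<rangle>))" .
  qed simp
  finally show ?thesis by (simp add: scaleR_sum_right)
qed

lemma bst_mean_rec_real:
  "n \<ge> 2 \<Longrightarrow> bst_mean n g =
    (\<Sum>i=1..<n. bst_mean i (\<lambda>l. bst_mean (n - i) (\<lambda>r. g \<langle>l, (), r\<rangle>))) / (real n - 1)"
  by (simp add: bst_mean_rec)

lemma bst_mean_product:
  "bst_mean m (\<lambda>l. bst_mean n (\<lambda>r. f l * g r)) = bst_mean m f * bst_mean n (g :: _ \<Rightarrow> 'a :: real_algebra)"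
  by (simp add: bst_mean_mult_left bst_mean_mult_right)

lemma set_pmf_random_bst: "n \<ge> 1 \<Longrightarrow> set_pmf (random_bst n) \<subseteq> {t. size1 t = n}"
  by (auto simp: set_pmf_eq pmf_random_bst)

lemma integral_random_bst:
  fixes f :: "btree \<Rightarrow> 'a :: {banach, second_countable_topology}"
  assumes "n \<ge> 1"
  shows "measure_pmf.expectation (random_bst n) f = bst_mean n f"
proof -
  have "measure_pmf.expectation (random_bst n) f = (\<Sum>t | size1 t = n. pmf (random_bst n) t *\<^sub>R f t)"
    using assms set_pmf_random_bst[OF assms]
    by (intro integral_measure_pmf finite_trees) auto
  also have "\<dots> = bst_mean n f"
    unfolding bst_mean_def using assms by (intro sum.cong) (auto simp: pmf_random_bst)
  finally show ?thesis .
qed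

lemma prob_random_bst:
  assumes "n \<ge> 1"
  shows "measure_pmf.prob (random_bst n) A = bst_mean n (\<lambda>t. of_bool (t \<in> A))"
proof -
  have "measure_pmf.prob (random_bst n) A = measure_pmf.expectation (random_bst n) (indicator A)"
    by simp
  also have "\<dots> = bst_mean n (indicator A)" using assms by (rule integral_random_bst)
  also have "\<dots> = bst_mean n (\<lambda>t. of_bool (t \<in> A))"
    by (rule bst_mean_cong) (simp add: indicator_def)
  finally show ?thesis .
qed

section \<open>Collision probabilities\<close>

definition iso_class_prob :: "btree \<Rightarrow> real" where
  "iso_class_prob s = bst_mean (size1 s) (\<lambda>t. of_bool (isomorphic s t))"

text \<open>
  Symmetrical roots bring higher moments into the recurrence: four isomorphic subtrees of size \<open>n/2\<close>
  replace two pairs of isomorphic subtrees. For \<open>p = 1\<close> this is the paper's \<open>P_n^1\<close>.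
\<close>

definition class_moment :: "nat \<Rightarrow> nat \<Rightarrow> real" where
  "class_moment p n = bst_mean n (\<lambda>t. iso_class_prob t ^ p)"

lemma bst_mean_isomorphic:
  "bst_mean n (\<lambda>t. of_bool (isomorphic s t)) = (if size1 s = n then iso_class_prob s else 0)"
proof (cases "size1 s = n")
  case False
  then have "bst_mean n (\<lambda>t. of_bool (isomorphic s t) :: real) = bst_mean n (\<lambda>_. 0)"
    by (intro bst_mean_cong) (auto dest: isomorphic_size1)
  then show ?thesis using False by simp
qed (simp add: iso_class_prob_def)

lemma iso_class_prob_cong:
  assumes "isomorphic s t"
  shows "iso_class_prob s = iso_class_prob t"
proof -
  have "isomorphic s u \<longleftrightarrow> isomorphic t u" for u
    using assms by (meson isomorphic_sym isomorphic_trans)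
  then show ?thesis using isomorphic_size1[OF assms] by (simp add: iso_class_prob_def)
qed

text \<open>Conditioning on the first tree turns the collision probability into the expected
  probability of its isomorphism class.\<close>

lemma iso_prob_eq: "k \<ge> 1 \<Longrightarrow> iso_prob k = class_moment 1 k"
proof -
  assume k: "k \<ge> 1"
  let ?T = "{t :: btree. size1 t = k}"
  have "iso_prob k = measure_pmf.expectation (pair_pmf (random_bst k) (random_bst k))
      (indicator {(s, t). isomorphic s t})"
    by (simp add: iso_prob_def)
  also have "\<dots> = (\<Sum>x\<in>?T \<times> ?T. pmf (pair_pmf (random_bst k) (random_bst k)) x *\<^sub>R
      indicator {(s, t). isomorphic s t} x)"
    using set_pmf_random_bst[OF k] by (intro integral_measure_pmf finite_SigmaI finite_trees) auto
  also have "\<dots> = (\<Sum>(s, t)\<in>?T \<times> ?T. P_bst s *\<^sub>R P_bst t *\<^sub>R of_bool (isomorphic s t))"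
    using k by (intro sum.cong) (auto simp: pmf_pair pmf_random_bst indicator_def)
  also have "\<dots> = bst_mean k (\<lambda>s. bst_mean k (\<lambda>t. of_bool (isomorphic s t)))"
    by (simp add: bst_mean_def sum_distrib_left sum.cartesian_product)
  also have "\<dots> = class_moment 1 k"
    unfolding class_moment_def by (intro bst_mean_cong) (simp add: iso_class_prob_def)
  finally show ?thesis .
qed

lemma size1_ge_1: "Suc 0 \<le> size1 t" using size1_pos[of t] by simp

text \<open>The children match in one of two orders. If \<open>l\<close> and \<open>r\<close> are
  not isomorphic, these are disjoint events of equal probability; otherwise they are the same event.
  This explains the factor.\<close>

lemma iso_class_prob_Node:
  "iso_class_prob \<langle>l, x, r\<rangle> =
     (2 - of_bool (isomorphic l r)) * iso_class_prob l * iso_class_prob r / (real (size1 l + size1 r) - 1)"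
proof -
  define n where "n = size1 l + size1 r"
  let ?iso = "\<lambda>s t. of_bool (isomorphic s t) :: real"
  let ?q = iso_class_prob
  have n: "n \<ge> 2" using size1_pos[of l] size1_pos[of r] by (simp add: n_def)
  \<comment> \<open>For isomorphic \<open>l\<close> and \<open>r\<close> the first order implies the
    second and is dropped; otherwise the two orders exclude each other and the indicators add
    up.\<close>
  have expand: "?iso \<langle>l, x, r\<rangle> \<langle>l', (), r'\<rangle> =
      (1 - ?iso l r) * (?iso l l' * ?iso r r') + ?iso r l' * ?iso l r'" for l' r'
  proof -
    have "isomorphic l r \<Longrightarrow> isomorphic l l' \<and> isomorphic r r' \<Longrightarrow> isomorphic r l' \<and> isomorphic l r'"
      by (meson isomorphic_sym isomorphic_trans)
    moreover have "isomorphic l l' \<Longrightarrow> isomorphic r l' \<Longrightarrow> isomorphic l r"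
      by (meson isomorphic_sym isomorphic_trans)
    ultimately show ?thesis
      unfolding isomorphic_Node
      by (cases "isomorphic l r"; cases "isomorphic l l'"; cases "isomorphic r r'";
          cases "isomorphic l r'"; cases "isomorphic r l'") (simp_all only: of_bool_def, simp_all)
  qed
  \<comment> \<open>Isomorphic trees have equal size, so a single split \<open>i\<close>
    contributes.\<close>
  have single: "(\<Sum>i=1..<n. bst_mean i (?iso s) * bst_mean (n - i) (?iso t)) = ?q s * ?q t"
    if "size1 s + size1 t = n" for s t
  proof -
    have "(\<Sum>i=1..<n. bst_mean i (?iso s) * bst_mean (n - i) (?iso t)) =
        (\<Sum>i=1..<n. if i = size1 s then ?q s * ?q t else 0)"
      using that by (intro sum.cong) (auto simp: bst_mean_isomorphic)
    also have "\<dots> = ?q s * ?q t"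
      using that size1_ge_1[of s] size1_ge_1[of t] by (simp add: sum.delta')
    finally show ?thesis .
  qed
  have "?q \<langle>l, x, r\<rangle> = bst_mean n (?iso \<langle>l, x, r\<rangle>)"
    by (simp add: iso_class_prob_def n_def)
  also have "\<dots> = ((1 - ?iso l r) * (\<Sum>i=1..<n. bst_mean i (?iso l) * bst_mean (n - i) (?iso r))
      + (\<Sum>i=1..<n. bst_mean i (?iso r) * bst_mean (n - i) (?iso l))) / (real n - 1)"
    unfolding bst_mean_rec_real[OF n] expand
    by (simp add: bst_mean_add bst_mean_mult_left bst_mean_mult_right sum.distrib sum_distrib_left)
  also have "\<dots> = (2 - ?iso l r) * ?q l * ?q r / (real n - 1)"
    using single[of l r] single[of r l] by (simp add: n_def[symmetric] algebra_simps)
  finally show ?thesis by (simp add: n_def)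
qed

text \<open>Isomorphic subtrees have equal size, so only the split into halves survives; averaging
  over \<open>r\<close> then leaves the class probability of \<open>l\<close>.\<close>

lemma bst_mean_isomorphic_split:
  "(\<Sum>i=1..<n. bst_mean i (\<lambda>l. bst_mean (n - i) (\<lambda>r. of_bool (isomorphic l r) * f l))) =
    (if even n then bst_mean (n div 2) (\<lambda>l. iso_class_prob l * f l :: real) else 0)"
proof -
  have "(\<Sum>i=1..<n. bst_mean i (\<lambda>l. bst_mean (n - i) (\<lambda>r. of_bool (isomorphic l r) * f l))) =
      (\<Sum>i=1..<n. if i = n - i then bst_mean i (\<lambda>l. iso_class_prob l * f l) else 0)"
  proof (intro sum.cong refl)
    fix i
    have "bst_mean i (\<lambda>l. bst_mean (n - i) (\<lambda>r. of_bool (isomorphic l r) * f l)) =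
        bst_mean i (\<lambda>l. (if i = n - i then iso_class_prob l * f l else 0))"
      by (intro bst_mean_cong) (simp add: bst_mean_mult_right bst_mean_isomorphic)
    then show "bst_mean i (\<lambda>l. bst_mean (n - i) (\<lambda>r. of_bool (isomorphic l r) * f l)) =
        (if i = n - i then bst_mean i (\<lambda>l. iso_class_prob l * f l) else 0)"
      by simp
  qed
  also have "\<dots> = (if even n then bst_mean (n div 2) (\<lambda>l. iso_class_prob l * f l) else 0)"
  proof (cases "even n \<and> n \<noteq> 0")
    case True
    then obtain m where m: "n = 2 * m" "m \<ge> 1" by (auto elim: evenE)
    have "(\<Sum>i=1..<n. if i = n - i then bst_mean i (\<lambda>l. iso_class_prob l * f l) else 0) =
      (\<Sum>i=1..<n. if i = m then bst_mean m (\<lambda>l. iso_class_prob l * f l) else 0)"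
      using m by (intro sum.cong) auto
    then show ?thesis using m by simp
  next
    case False
    have "i \<noteq> n - i" if "i \<in> {1..<n}" for i using that False by auto presburger
    \<comment> \<open>The size \<open>n = 0\<close> counts as even; there the right-hand side
      vanishes because no tree is without leaves.\<close>
    moreover have "bst_mean 0 (\<lambda>l. iso_class_prob l * f l) = 0" by (simp add: bst_mean_def size1_size)
    ultimately show ?thesis using False by (auto intro!: sum.neutral)
  qed
  finally show ?thesis .
qed

lemma class_moment_size_1: "class_moment p 1 = 1"
  unfolding class_moment_def bst_mean_1 iso_class_prob_def size1.simps by (simp add: bst_mean_1[simplified])

text \<open>The factor in \<open>iso_class_prob_Node\<close> contributes \<open>2 ^ p\<close> to the
  power, except at a symmetrical root, where it is 1; the subtracted term corrects this. At a
  symmetrical root both class probabilities agree, which gives the exponent \<open>2 * p\<close>,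
  and averaging over the right subtree adds one more factor.\<close>

lemma class_moment_rec:
  assumes n: "n \<ge> 2"
  shows "class_moment p n = (2 ^ p * (\<Sum>i=1..<n. class_moment p i * class_moment p (n - i))
     - (2 ^ p - 1) * (if even n then class_moment (2 * p + 1) (n div 2) else 0)) / (real n - 1) ^ Suc p"
proof -
  let ?q = iso_class_prob and ?iso = "\<lambda>s t. of_bool (isomorphic s t) :: real"
  have "bst_mean i (\<lambda>l. bst_mean (n - i) (\<lambda>r. ?q \<langle>l, (), r\<rangle> ^ p)) =
      bst_mean i (\<lambda>l. bst_mean (n - i) (\<lambda>r.
        (2 ^ p * (?q l ^ p * ?q r ^ p) - (2 ^ p - 1) * (?iso l r * ?q l ^ (2 * p))) / (real n - 1) ^ p))"
    if i: "i \<in> {1..<n}" for i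
  proof (intro bst_mean_cong)
    fix l r :: btree assume lr: "size1 l = i" "size1 r = n - i"
    then have nn: "size1 l + size1 r = n" using i by simp
    have "?q l ^ (2 * p) = ?q l ^ p * ?q r ^ p" if "isomorphic l r"
      using iso_class_prob_cong[OF that] by (simp add: mult_2 power_add)
    then show "?q \<langle>l, (), r\<rangle> ^ p =
        (2 ^ p * (?q l ^ p * ?q r ^ p) - (2 ^ p - 1) * (?iso l r * ?q l ^ (2 * p))) / (real n - 1) ^ p"
      unfolding iso_class_prob_Node nn by (simp add: power_mult_distrib power_divide algebra_simps)
  qed
  then have "class_moment p n = (\<Sum>i=1..<n. bst_mean i (\<lambda>l. bst_mean (n - i) (\<lambda>r.
        (2 ^ p * (?q l ^ p * ?q r ^ p) - (2 ^ p - 1) * (?iso l r * ?q l ^ (2 * p))) / (real n - 1) ^ p))) / (real n - 1)"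
    unfolding class_moment_def bst_mean_rec_real[OF n] by (intro arg_cong2[where f = "(/)"] sum.cong refl) blast
  also have "\<dots> = (2 ^ p * (\<Sum>i=1..<n. class_moment p i * class_moment p (n - i))
     - (2 ^ p - 1) * (\<Sum>i=1..<n. bst_mean i (\<lambda>l. bst_mean (n - i) (\<lambda>r. ?iso l r * ?q l ^ (2 * p))))) / (real n - 1) ^ Suc p"
    unfolding bst_mean_divide bst_mean_diff bst_mean_mult_left[of _ "2 ^ p"] bst_mean_mult_left[of _ "2 ^ p - 1"]
      bst_mean_product class_moment_def
    by (simp add: sum_subtractf diff_divide_distrib sum_distrib_left sum_divide_distrib mult_ac)
  also have "(\<Sum>i=1..<n. bst_mean i (\<lambda>l. bst_mean (n - i) (\<lambda>r. ?iso l r * ?q l ^ (2 * p)))) =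
      (if even n then class_moment (2 * p + 1) (n div 2) else 0)"
    unfolding bst_mean_isomorphic_split by (simp add: class_moment_def)
  finally show ?thesis .
qed

lemma class_moment_nonneg: "0 \<le> class_moment p n"
  unfolding class_moment_def iso_class_prob_def by (intro bst_mean_nonneg zero_le_power) simp

section \<open>Exact collision probabilities of small trees and a geometric bound\<close>

lemma upt_1_numeral: "1 < (numeral n :: nat) \<Longrightarrow> [1..<numeral n] = 1 # [2..<numeral n :: nat]"
  by (metis One_nat_def Suc_1 upt_conv_Cons)

text \<open>With a list in place of the interval the simplifier can unfold the sum at
  numerals.\<close>

lemma class_moment_rec_list:
  assumes "n \<ge> 2"
  shows "class_moment p n = (2 ^ p * (\<Sum>i\<leftarrow>[1..<n]. class_moment p i * class_moment p (n - i))
     - (2 ^ p - 1) * (if even n then class_moment (2 * p + 1) (n div 2) else 0)) / (real n - 1) ^ Suc p"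
  unfolding class_moment_rec[OF assms] by (simp only: interv_sum_list_conv_sum_set_nat set_upt)

text \<open>Each even size calls for the moment of order \<open>2 * p + 1\<close> at half the size.
  Order 1 up to size 25 thus requires order 3 up to 12, order 7 up to 6, order 15 up to 3 and
  finally order 31 at size 1.\<close>

lemma class_moment_31: "class_moment 31 1 = 1"
  by (rule class_moment_size_1)

lemma class_moment_15:
  shows "class_moment 15 1 = 1"
    and "class_moment 15 2 = 1"
    and "class_moment 15 3 = 1"
proof -
  note One_nat_def [simp del]
  note [simp] = upt_1_numeral class_moment_size_1 class_moment_size_1[unfolded One_nat_def] class_moment_31
  show "class_moment 15 1 = 1" by simp
  show [simp]: "class_moment 15 2 = 1" by (subst class_moment_rec_list) simp_all
  show [simp]: "class_moment 15 3 = 1" by (subst class_moment_rec_list) simp_all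
qed

lemma class_moment_7:
  shows "class_moment 7 1 = 1"
    and "class_moment 7 2 = 1"
    and "class_moment 7 3 = 1"
    and "class_moment 7 4 = 257 / 6561"
    and "class_moment 7 5 = 3409 / 839808"
    and "class_moment 7 6 = 79171 / 2562890625"
proof -
  note One_nat_def [simp del]
  note [simp] = upt_1_numeral class_moment_size_1 class_moment_size_1[unfolded One_nat_def] class_moment_15
  show "class_moment 7 1 = 1" by simp
  show [simp]: "class_moment 7 2 = 1" by (subst class_moment_rec_list) simp_all
  show [simp]: "class_moment 7 3 = 1" by (subst class_moment_rec_list) simp_all
  show [simp]: "class_moment 7 4 = 257 / 6561" by (subst class_moment_rec_list) simp_all
  show [simp]: "class_moment 7 5 = 3409 / 839808" by (subst class_moment_rec_list) simp_all
  show [simp]: "class_moment 7 6 = 79171 / 2562890625" by (subst class_moment_rec_list) simp_all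
qed

lemma class_moment_3:
  shows "class_moment 3 1 = 1"
    and "class_moment 3 2 = 1"
    and "class_moment 3 3 = 1"
    and "class_moment 3 4 = 17 / 81"
    and "class_moment 3 5 = 49 / 648"
    and "class_moment 3 6 = 451 / 50625"
    and "class_moment 3 7 = 119233 / 32805000"
    and "class_moment 3 8 = 6104837 / 9845600625"
    and "class_moment 3 9 = 1143412601 / 10081895040000"
    and "class_moment 3 10 = 147615946267 / 8268414169680000"
    and "class_moment 3 11 = 28943247288061 / 8268414169680000000"
    and "class_moment 3 12 = 1671125889268391 / 2702184193265287500000"
proof -
  note One_nat_def [simp del]
  note [simp] = upt_1_numeral class_moment_size_1 class_moment_size_1[unfolded One_nat_def] class_moment_7
  show "class_moment 3 1 = 1" by simp
  show [simp]: "class_moment 3 2 = 1" by (subst class_moment_rec_list) simp_all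
  show [simp]: "class_moment 3 3 = 1" by (subst class_moment_rec_list) simp_all
  show [simp]: "class_moment 3 4 = 17 / 81" by (subst class_moment_rec_list) simp_all
  show [simp]: "class_moment 3 5 = 49 / 648" by (subst class_moment_rec_list) simp_all
  show [simp]: "class_moment 3 6 = 451 / 50625" by (subst class_moment_rec_list) simp_all
  show [simp]: "class_moment 3 7 = 119233 / 32805000" by (subst class_moment_rec_list) simp_all
  show [simp]: "class_moment 3 8 = 6104837 / 9845600625" by (subst class_moment_rec_list) simp_all
  show [simp]: "class_moment 3 9 = 1143412601 / 10081895040000" by (subst class_moment_rec_list) simp_all
  show [simp]: "class_moment 3 10 = 147615946267 / 8268414169680000" by (subst class_moment_rec_list) simp_all
  show [simp]: "class_moment 3 11 = 28943247288061 / 8268414169680000000" by (subst class_moment_rec_list) simp_all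
  show [simp]: "class_moment 3 12 = 1671125889268391 / 2702184193265287500000" by (subst class_moment_rec_list) simp_all
qed

lemma class_moment_1:
  shows "class_moment 1 1 = 1"
    and "class_moment 1 2 = 1"
    and "class_moment 1 3 = 1"
    and "class_moment 1 4 = 5 / 9"
    and "class_moment 1 5 = 7 / 18"
    and "class_moment 1 6 = 43 / 225"
    and "class_moment 1 7 = 511 / 4050"
    and "class_moment 1 8 = 187 / 2835"
    and "class_moment 1 9 = 1699 / 45360"
    and "class_moment 1 10 = 178027 / 9185400"
    and "class_moment 1 11 = 981793 / 91854000"
    and "class_moment 1 12 = 5552999 / 992351250"
    and "class_moment 1 13 = 421707169 / 142898580000"
    and "class_moment 1 14 = 21414969001 / 14087418345000"
    and "class_moment 1 15 = 6596829857777 / 8283401986860000"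
    and "class_moment 1 16 = 333167267256547 / 815397383081531250"
    and "class_moment 1 17 = 88059975556083961 / 417483460137744000000"
    and "class_moment 1 18 = 4329399721292974457 / 40217573326602672000000"
    and "class_moment 1 19 = 19225990225807239773 / 349031082798730332000000"
    and "class_moment 1 20 = 12343380507012841718767 / 441000773116195774482000000"
    and "class_moment 1 21 = 96492354572612351037731 / 6784627278710704222800000000"
    and "class_moment 1 22 = 4305304151430624896445613 / 598404125982284112450960000000"
    and "class_moment 1 23 = 34245400365698823964794457883 / 9412896901701329088853600800000000"
    and "class_moment 1 24 = 47555070954613115683844524157 / 25934491984375016083351848037500000"
    and "class_moment 1 25 = 331074002946976689273492037599473 / 358518417192000222336255947270400000000"
proof -
  note One_nat_def [simp del]
  note [simp] = upt_1_numeral class_moment_size_1 class_moment_size_1[unfolded One_nat_def] class_moment_3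
  show "class_moment 1 1 = 1" by simp
  show [simp]: "class_moment 1 2 = 1" by (subst class_moment_rec_list) simp_all
  show [simp]: "class_moment 1 3 = 1" by (subst class_moment_rec_list) simp_all
  show [simp]: "class_moment 1 4 = 5 / 9" by (subst class_moment_rec_list) simp_all
  show [simp]: "class_moment 1 5 = 7 / 18" by (subst class_moment_rec_list) simp_all
  show [simp]: "class_moment 1 6 = 43 / 225" by (subst class_moment_rec_list) simp_all
  show [simp]: "class_moment 1 7 = 511 / 4050" by (subst class_moment_rec_list) simp_all
  show [simp]: "class_moment 1 8 = 187 / 2835" by (subst class_moment_rec_list) simp_all
  show [simp]: "class_moment 1 9 = 1699 / 45360" by (subst class_moment_rec_list) simp_all
  show [simp]: "class_moment 1 10 = 178027 / 9185400" by (subst class_moment_rec_list) simp_all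
  show [simp]: "class_moment 1 11 = 981793 / 91854000" by (subst class_moment_rec_list) simp_all
  show [simp]: "class_moment 1 12 = 5552999 / 992351250" by (subst class_moment_rec_list) simp_all
  show [simp]: "class_moment 1 13 = 421707169 / 142898580000" by (subst class_moment_rec_list) simp_all
  show [simp]: "class_moment 1 14 = 21414969001 / 14087418345000" by (subst class_moment_rec_list) simp_all
  show [simp]: "class_moment 1 15 = 6596829857777 / 8283401986860000" by (subst class_moment_rec_list) simp_all
  show [simp]: "class_moment 1 16 = 333167267256547 / 815397383081531250" by (subst class_moment_rec_list) simp_all
  show [simp]: "class_moment 1 17 = 88059975556083961 / 417483460137744000000" by (subst class_moment_rec_list) simp_all
  show [simp]: "class_moment 1 18 = 4329399721292974457 / 40217573326602672000000" by (subst class_moment_rec_list) simp_all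
  show [simp]: "class_moment 1 19 = 19225990225807239773 / 349031082798730332000000" by (subst class_moment_rec_list) simp_all
  show [simp]: "class_moment 1 20 = 12343380507012841718767 / 441000773116195774482000000" by (subst class_moment_rec_list) simp_all
  show [simp]: "class_moment 1 21 = 96492354572612351037731 / 6784627278710704222800000000" by (subst class_moment_rec_list) simp_all
  show [simp]: "class_moment 1 22 = 4305304151430624896445613 / 598404125982284112450960000000" by (subst class_moment_rec_list) simp_all
  show [simp]: "class_moment 1 23 = 34245400365698823964794457883 / 9412896901701329088853600800000000" by (subst class_moment_rec_list) simp_all
  show [simp]: "class_moment 1 24 = 47555070954613115683844524157 / 25934491984375016083351848037500000" by (subst class_moment_rec_list) simp_all
  show [simp]: "class_moment 1 25 = 331074002946976689273492037599473 / 358518417192000222336255947270400000000" by (subst class_moment_rec_list) simp_all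
qed

text \<open>
  For \<open>k \<le> 25\<close> the bound is read off the table; beyond, the recurrence reproduces it because
  \<open>2 * 12 \<le> k - 1\<close>.
\<close>

lemma class_moment_1_le: "k \<ge> 1 \<Longrightarrow> class_moment 1 k \<le> 12 * (53 / 100) ^ k"
proof (induction k rule: less_induct)
  case (less k)
  show ?case
  proof (cases "k \<le> 25")
    case True
    then have "k \<in> set [1..<26]" using less.prems by simp
    then show ?thesis
      by (simp add: upt_1_numeral del: set_upt One_nat_def) (elim disjE; simp add: class_moment_1 power_divide del: One_nat_def)
  next
    case False
    have k: "k \<ge> 2" using False by simp
    \<comment> \<open>The correction for symmetrical roots is subtracted and may be dropped in an
      upper bound.\<close>
    have "class_moment 1 k \<le> 2 * (\<Sum>i=1..<k. class_moment 1 i * class_moment 1 (k - i)) / (real k - 1) ^ 2"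
      unfolding class_moment_rec[OF k, of 1] Suc_1
      using class_moment_nonneg[of 3 "k div 2"] by (intro divide_right_mono) auto
    also have "(\<Sum>i=1..<k. class_moment 1 i * class_moment 1 (k - i)) \<le> (\<Sum>i=1..<k. 144 * (53 / 100) ^ k)"
    proof (rule sum_mono)
      fix i assume i: "i \<in> {1..<k}"
      have "class_moment 1 i * class_moment 1 (k - i) \<le> (12 * (53 / 100) ^ i) * (12 * (53 / 100) ^ (k - i))"
        using i class_moment_nonneg by (intro mult_mono less.IH) auto
      also have "\<dots> = 144 * (53 / 100) ^ (i + (k - i))" by (simp only: power_add)
      finally show "class_moment 1 i * class_moment 1 (k - i) \<le> 144 * (53 / 100) ^ k" using i by simp
    qed
    also have "\<dots> = (real k - 1) * (144 * (53 / 100) ^ k)"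
      using k by (simp add: of_nat_diff)
    also have "2 * ((real k - 1) * (144 * (53 / 100) ^ k)) / (real k - 1) ^ 2 =
        288 / (real k - 1) * (53 / 100) ^ k"
      using k by (simp add: power2_eq_square)
    also have "\<dots> \<le> 12 * (53 / 100) ^ k"
      using False by (intro mult_right_mono) (auto simp: field_simps)
    finally show ?thesis by (simp add: divide_right_mono)
  qed
qed

section \<open>The series for the constant nu\<close>

definition nu_term :: "nat \<Rightarrow> real" where
  "nu_term k = iso_prob k / (real k * (2 * real k + 1) * (2 * real k - 1))"

lemma nu_term_0 [simp]: "nu_term 0 = 0"
  by (simp add: nu_term_def)

lemma nu_term_eq: "k \<ge> 1 \<Longrightarrow> nu_term k = class_moment 1 k / (real k * (2 * real k + 1) * (2 * real k - 1))"
  by (simp add: nu_term_def iso_prob_eq)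

lemma nu_term_nonneg: "0 \<le> nu_term k"
proof (cases "k = 0")
  case False
  then have "2 * real k - 1 \<ge> 0" by simp
  then show ?thesis using False class_moment_nonneg[of 1 k] by (simp add: nu_term_eq Suc_le_eq)
qed simp

text \<open>The polynomial denominator is frozen at \<open>K\<close>: \<open>K = 1\<close> suffices
  for convergence, \<open>K = 26\<close> serves the tail behind the tabulated terms.\<close>

lemma nu_term_le:
  assumes "1 \<le> K" "K \<le> k"
  shows "nu_term k \<le> 12 * (53 / 100) ^ k / (real K * (2 * real K + 1) * (2 * real K - 1))"
  unfolding nu_term_eq[OF order.trans[OF assms]]
  using assms by (intro frac_le class_moment_1_le mult_mono mult_pos_pos mult_nonneg_nonneg) auto

lemma summable_nu_term: "summable nu_term"
proof (rule summable_comparison_test)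
  show "\<exists>N. \<forall>n\<ge>N. norm (nu_term n) \<le> 12 * (53 / 100) ^ n / (real 1 * (2 * real 1 + 1) * (2 * real 1 - 1))"
    using nu_term_le[of 1] nu_term_nonneg by (intro exI[of _ 1]) auto
  show "summable (\<lambda>n. 12 * (53 / 100 :: real) ^ n / (real 1 * (2 * real 1 + 1) * (2 * real 1 - 1)))"
    by (intro summable_divide summable_mult summable_geometric) auto
qed

text \<open>Division by zero makes the term at 0 vanish, so the series over all naturals is the sum
  from 1 on; nonnegativity makes it unconditional.\<close>

lemma has_sum_nu_term: "(nu_term has_sum suminf nu_term) {1..}"
proof -
  have "(nu_term has_sum suminf nu_term) UNIV"
    using summable_nu_term nu_term_nonneg by (intro norm_summable_imp_has_sum summable_sums) auto
  then show ?thesis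
    by (rule has_sum_cong_neutral[THEN iffD1, rotated -1]) (auto simp: not_less_eq_eq)
qed

lemma suminf_nu_term_bounds: "\<bar>suminf nu_term - 0.3795493473\<bar> \<le> 1 / 2 * (1 / 10 ^ 10)"
proof -
  \<comment> \<open>The denominator is \<open>K * (2 * K + 1) * (2 * K - 1)\<close> at
    \<open>K = 26\<close>, the first index outside the table.\<close>
  let ?c = "12 / (26 * 53 * 51) :: real"
  have split: "suminf nu_term = (\<Sum>k. nu_term (k + 26)) + (\<Sum>k<26. nu_term k)"
    by (rule suminf_split_initial_segment[OF summable_nu_term])
  have "(\<Sum>k<26. nu_term k) = (\<Sum>k\<leftarrow>0 # [1..<26]. nu_term k)"
    unfolding lessThan_atLeast0 
    by (subst sum.atLeast_Suc_lessThan) (simp_all add: interv_sum_list_conv_sum_set_nat)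
  also have "\<dots> = 7429456867353383333002655644806111104284993222451207 / 19574416136124066324821814880407327133193760000000000"
    by (simp add: upt_1_numeral nu_term_eq class_moment_1 del: One_nat_def)
  finally have part: "(\<Sum>k<26. nu_term k) = 7429456867353383333002655644806111104284993222451207 / 19574416136124066324821814880407327133193760000000000" .
  have "(\<lambda>k. ?c * (53 / 100) ^ 26 * (53 / 100) ^ k) sums (?c * (53 / 100) ^ 26 * (1 / (1 - 53 / 100)))"
    by (intro sums_mult geometric_sums) auto
  moreover have "nu_term (k + 26) \<le> ?c * (53 / 100) ^ 26 * (53 / 100) ^ k" for k
    using nu_term_le[of 26 "k + 26"] by (simp add: power_add mult_ac)
  ultimately have "(\<Sum>k. nu_term (k + 26)) \<le> ?c * (53 / 100) ^ 26 * (1 / (1 - 53 / 100))"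
    using summable_ignore_initial_segment[OF summable_nu_term, of 26]
    by (metis (no_types, lifting) sums_le summable_sums)
  \<comment> \<open>This is half of the permitted error; as the tail is also nonnegative, the exact
    partial sum settles the rest.\<close>
  also have "\<dots> \<le> 25 / 10 ^ 12" by (simp add: power_divide)
  finally have "(\<Sum>k. nu_term (k + 26)) \<le> 25 / 10 ^ 12" .
  moreover have "0 \<le> (\<Sum>k. nu_term (k + 26))"
    using summable_ignore_initial_segment[OF summable_nu_term, of 26] nu_term_nonneg by (intro suminf_nonneg)
  ultimately show ?thesis unfolding split part by (simp add: abs_le_iff) 
qed

section \<open>The linear recurrence of additive tree functionals\<close>

text \<open>The rate is not fixed, so the class is closed under polynomial factors and convolutions.
  The bound covers every \<open>n\<close> and thus yields uniform bounds as well as limits.\<close>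

definition exp_small :: "(nat \<Rightarrow> real) \<Rightarrow> bool" where
  "exp_small f \<longleftrightarrow> (\<exists>C r. 0 < r \<and> r < 1 \<and> (\<forall>n. \<bar>f n\<bar> \<le> C * r ^ n))"

lemma exp_smallI: "0 < r \<Longrightarrow> r < 1 \<Longrightarrow> (\<And>n. \<bar>f n\<bar> \<le> C * r ^ n) \<Longrightarrow> exp_small f"
  unfolding exp_small_def by blast

lemma exp_smallE:
  assumes "exp_small f"
  obtains r C where "0 < r" "r < 1" "0 \<le> C" "\<forall>n. \<bar>f n\<bar> \<le> C * r ^ n"
proof -
  obtain C r where r: "0 < r" "r < 1" and f: "\<forall>n. \<bar>f n\<bar> \<le> C * r ^ n"
    using assms unfolding exp_small_def by blast
  moreover have "0 \<le> C" using f[rule_format, of 0] by simp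
  ultimately show ?thesis by (intro that)
qed

lemma exp_small_mono: "exp_small f \<Longrightarrow> (\<And>n. \<bar>g n\<bar> \<le> \<bar>f n\<bar>) \<Longrightarrow> exp_small g"
  unfolding exp_small_def by (blast intro: order.trans)

lemma exp_small2E:
  assumes "exp_small f" "exp_small g"
  obtains r C where "0 < r" "r < 1" "0 \<le> C" "\<forall>n. \<bar>f n\<bar> \<le> C * r ^ n" "\<forall>n. \<bar>g n\<bar> \<le> C * r ^ n"
proof -
  obtain r C where f: "0 < r" "r < 1" "0 \<le> C" "\<forall>n. \<bar>f n\<bar> \<le> C * r ^ n"
    by (rule exp_smallE[OF assms(1)])
  obtain s D where g: "0 < s" "s < 1" "0 \<le> D" "\<forall>n. \<bar>g n\<bar> \<le> D * s ^ n"
    by (rule exp_smallE[OF assms(2)])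
  have "C * r ^ n \<le> max C D * max r s ^ n" "D * s ^ n \<le> max C D * max r s ^ n" for n
    using f g by (auto intro!: mult_mono power_mono)
  then show ?thesis
    using f g by (intro that[of "max r s" "max C D"]) (auto intro: order.trans[OF f(4)[rule_format]] order.trans[OF g(4)[rule_format]])
qed

lemma exp_small_add:
  assumes "exp_small f" "exp_small g"
  shows "exp_small (\<lambda>n. f n + g n)"
proof -
  obtain r C where *: "0 < r" "r < 1" "0 \<le> C" "\<forall>n. \<bar>f n\<bar> \<le> C * r ^ n" "\<forall>n. \<bar>g n\<bar> \<le> C * r ^ n"
    by (rule exp_small2E[OF assms])
  have "\<bar>f n + g n\<bar> \<le> (2 * C) * r ^ n" for n
    using *(4)[rule_format, of n] *(5)[rule_format, of n] by simp
  then show ?thesis using * by (intro exp_smallI)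
qed

lemma exp_small_cmult:
  assumes "exp_small f"
  shows "exp_small (\<lambda>n. c * f n)"
proof -
  obtain r C where *: "0 < r" "r < 1" "0 \<le> C" "\<forall>n. \<bar>f n\<bar> \<le> C * r ^ n"
    by (rule exp_smallE[OF assms])
  have "\<bar>c * f n\<bar> \<le> (\<bar>c\<bar> * C) * r ^ n" for n
    using mult_left_mono[OF *(4)[rule_format, of n], of "\<bar>c\<bar>"] by (simp add: abs_mult mult.assoc)
  then show ?thesis using * by (intro exp_smallI)
qed

lemma exp_small_of_nat_mult:
  assumes "exp_small f"
  shows "exp_small (\<lambda>n. real n * f n)"
proof -
  obtain r C where *: "0 < r" "r < 1" "0 \<le> C" "\<forall>n. \<bar>f n\<bar> \<le> C * r ^ n"
    by (rule exp_smallE[OF assms])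
  \<comment> \<open>Half of the decay pays for the factor \<open>n\<close>: the product
    \<open>n * s ^ n\<close> is bounded, and \<open>s ^ n\<close> remains.\<close>
  define s where "s = sqrt r"
  have s: "0 < s" "s < 1" "r = s * s" using * by (auto simp: s_def)
  have "(\<lambda>n. of_nat n * s ^ n) \<longlonglongrightarrow> 0" by (rule powser_times_n_limit_0) (use s in auto)
  then obtain K where K: "\<And>n. norm (of_nat n * s ^ n) \<le> K"
    using convergent_imp_Bseq[OF convergentI[of "\<lambda>n. of_nat n * s ^ n" 0]] unfolding Bseq_def by blast
  have "\<bar>real n * f n\<bar> \<le> (C * K) * s ^ n" for n
  proof -
    have "\<bar>real n * f n\<bar> \<le> real n * (C * (s * s) ^ n)"
      using *(4)[rule_format, of n] unfolding s(3)[symmetric] by (simp add: abs_mult mult_left_mono)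
    also have "\<dots> = (C * s ^ n) * (real n * s ^ n)" by (simp add: power_mult_distrib)
    also have "\<dots> \<le> (C * s ^ n) * K"
      using K[of n] * s by (intro mult_left_mono) auto
    finally show ?thesis by (simp add: mult_ac)
  qed
  then show ?thesis using s by (intro exp_smallI)
qed

lemma exp_small_power_mult: "exp_small f \<Longrightarrow> exp_small (\<lambda>n. real n ^ p * f n)"
proof (induction p)
  case (Suc p)
  show ?case using exp_small_of_nat_mult[OF Suc.IH[OF Suc.prems]] by (simp add: mult.assoc)
qed simp

lemma exp_small_bounded:
  assumes "exp_small f"
  obtains K where "0 \<le> K" "\<forall>n. \<bar>f n\<bar> \<le> K"
proof -
  obtain r C where *: "0 < r" "r < 1" "0 \<le> C" "\<forall>n. \<bar>f n\<bar> \<le> C * r ^ n"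
    by (rule exp_smallE[OF assms])
  have "C * r ^ n \<le> C" for n using * by (simp add: mult_left_le power_le_one)
  then show ?thesis using * by (intro that[of C]) (auto intro: order.trans[OF *(4)[rule_format]])
qed

lemma exp_small_tendsto_0:
  assumes "exp_small f"
  shows "f \<longlonglongrightarrow> 0"
proof -
  obtain r C where *: "0 < r" "r < 1" "0 \<le> C" "\<forall>n. \<bar>f n\<bar> \<le> C * r ^ n"
    by (rule exp_smallE[OF assms])
  have "(\<lambda>n. C * r ^ n) \<longlonglongrightarrow> 0"
    using * by (intro tendsto_mult_right_zero LIMSEQ_power_zero) auto
  then have "(\<lambda>n. \<bar>f n\<bar>) \<longlonglongrightarrow> 0"
    by (rule tendsto_sandwich[OF _ _ tendsto_const, rotated -1]) (use * in auto)
  then show ?thesis by (rule tendsto_rabs_zero_cancel)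
qed

text \<open>Every product is at most \<open>C\<^sup>2 * r ^ n\<close> because the exponents add up
  to \<open>n\<close>; the number of products costs a factor \<open>n\<close>, which
  \<open>exp_small_of_nat_mult\<close> absorbs.\<close>

lemma exp_small_convolution:
  assumes "exp_small f" "exp_small g"
  shows "exp_small (\<lambda>n. \<Sum>i=1..<n. f i * g (n - i))"
proof -
  obtain r C where *: "0 < r" "r < 1" "0 \<le> C" "\<forall>n. \<bar>f n\<bar> \<le> C * r ^ n" "\<forall>n. \<bar>g n\<bar> \<le> C * r ^ n"
    by (rule exp_small2E[OF assms])
  have "exp_small (\<lambda>n. real n * (C\<^sup>2 * r ^ n))"
    by (rule exp_small_of_nat_mult, rule exp_smallI[OF *(1,2)], subst abs_of_nonneg) (use * in auto)
  then show ?thesis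
  proof (rule exp_small_mono)
    fix n
    have "\<bar>\<Sum>i=1..<n. f i * g (n - i)\<bar> \<le> (\<Sum>i=1..<n. C\<^sup>2 * r ^ n)"
    proof (intro order.trans[OF sum_abs] sum_mono)
      fix i assume i: "i \<in> {1..<n}"
      have "\<bar>f i * g (n - i)\<bar> \<le> (C * r ^ i) * (C * r ^ (n - i))"
        unfolding abs_mult using * by (intro mult_mono) auto
      also have "\<dots> = C\<^sup>2 * r ^ (i + (n - i))" by (simp only: power_add power2_eq_square mult_ac)
      finally show "\<bar>f i * g (n - i)\<bar> \<le> C\<^sup>2 * r ^ n" using i by simp
    qed
    also have "\<dots> \<le> real n * (C\<^sup>2 * r ^ n)"
      using * by (auto intro!: mult_right_mono)
    finally show "\<bar>\<Sum>i=1..<n. f i * g (n - i)\<bar> \<le> \<bar>real n * (C\<^sup>2 * r ^ n)\<bar>"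
      using * by simp
  qed
qed

text \<open>The division by zero makes the recurrence say \<^term>\<open>x 1 = \<rho> 1\<close> for \<^term>\<open>n = (1::nat)\<close>.\<close>

lemma recurrence_solution:
  fixes x \<rho> :: "nat \<Rightarrow> real"
  assumes rec: "\<And>n. n \<ge> 1 \<Longrightarrow> x n = 2 / (real n - 1) * (\<Sum>i=1..<n. x i) + \<rho> n"
    and n: "n \<ge> 1"
  shows "x n = \<rho> n + real n * (\<Sum>m<n. 2 * \<rho> m / (real m * (real m + 1)))"
  using n
proof (induction n rule: dec_induct)
  \<comment> \<open>The only summand is the one at \<open>m = 0\<close>, which is zero by division
    by zero.\<close>
  case base
  show ?case using rec[of 1] by simp
next
  case (step n)
  let ?S = "\<lambda>n. \<Sum>i=1..<n. x i"
  define T where "T n = (\<Sum>m<n. 2 * \<rho> m / (real m * (real m + 1)))" for n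
  have n: "real n \<ge> 1" using step by simp
  \<comment> \<open>Clearing denominators in two consecutive instances and subtracting cancels the
    sum over all smaller sizes; a first-order recurrence is left.\<close>
  have "(real n - 1) * x n = 2 * ?S n + (real n - 1) * \<rho> n"
    using rec[of n] step(1) by (cases "n = 1") (auto simp: field_simps)
  moreover have "real n * x (Suc n) = 2 * ?S (Suc n) + real n * \<rho> (Suc n)"
    using rec[of "Suc n"] n by (simp add: field_simps)
  moreover have "?S (Suc n) = ?S n + x n" using step(1) by simp
  ultimately have "real n * (x (Suc n) - \<rho> (Suc n)) = (real n + 1) * x n - (real n - 1) * \<rho> n"
    by (simp add: algebra_simps)
  also have "\<dots> = 2 * \<rho> n + (real n + 1) * real n * T n"
    unfolding step.IH T_def[symmetric] by (simp add: algebra_simps)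
  also have "\<dots> = real n * ((real n + 1) * T (Suc n))"
  proof -
    have "real n * (real n + 1) \<noteq> 0" using n by simp
    then have "(real n + 1) * (real n * (2 * \<rho> n / (real n * (real n + 1)))) = 2 * \<rho> n"
      by (simp add: field_simps)
    then show ?thesis by (simp add: T_def algebra_simps)
  qed
  finally have "x (Suc n) - \<rho> (Suc n) = (real n + 1) * T (Suc n)" using n by simp
  then show ?case unfolding T_def[symmetric] by (simp add: algebra_simps)
qed

text \<open>Extending the finite sum in \<open>recurrence_solution\<close> to the whole series
  produces the linear term. The error is \<open>\<rho> n\<close> minus \<open>n\<close> times the
  tail, whose weights are at most \<open>1 / n\<close>, so the error stays geometric.\<close>

lemma recurrence_asymptotics:
  fixes x \<rho> :: "nat \<Rightarrow> real"
  assumes rec: "\<And>n. n \<ge> 1 \<Longrightarrow> x n = 2 / (real n - 1) * (\<Sum>i=1..<n. x i) + \<rho> n"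
    and small: "exp_small \<rho>" and x0: "x 0 = 0"
  defines "L \<equiv> (\<Sum>m. 2 * \<rho> m / (real m * (real m + 1)))"
  shows "summable (\<lambda>m. 2 * \<rho> m / (real m * (real m + 1)))" "exp_small (\<lambda>n. x n - L * real n)"
proof -
  let ?t = "\<lambda>m. 2 * \<rho> m / (real m * (real m + 1))"
  obtain r C where *: "0 < r" "r < 1" "0 \<le> C" "\<forall>n. \<bar>\<rho> n\<bar> \<le> C * r ^ n"
    by (rule exp_smallE[OF small])
  have t: "\<bar>?t m\<bar> \<le> 2 * C * r ^ m / real n" if "1 \<le> n" "n \<le> m" for m n
  proof -
    have "real n * 1 \<le> real m * (real m + 1)" using that by (intro mult_mono) auto
    then have "2 * \<bar>\<rho> m\<bar> / (real m * (real m + 1)) \<le> 2 * (C * r ^ m) / real n"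
      using that * by (intro frac_le mult_left_mono) auto
    then show ?thesis using that by (simp add: abs_mult mult.assoc)
  qed
  have geo: "(\<lambda>m. 2 * C * r ^ (m + n) / real n) sums (2 * C * r ^ n / real n * (1 / (1 - r)))" for n
  proof -
    have "(\<lambda>m. 2 * C * r ^ n / real n * r ^ m) sums (2 * C * r ^ n / real n * (1 / (1 - r)))"
      using * by (intro sums_mult geometric_sums) auto
    then show ?thesis by (simp add: power_add mult_ac)
  qed
  show summable: "summable ?t"
  proof -
    have "norm (?t (m + 1)) \<le> 2 * C * r ^ (m + 1) / real 1" for m
      unfolding real_norm_def by (rule t) auto
    then have "summable (\<lambda>m. ?t (m + 1))"
      by (rule summable_comparison_test'[OF sums_summable[OF geo[of 1]]])
    then show ?thesis by (subst (asm) summable_iff_shift)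
  qed
  show "exp_small (\<lambda>n. x n - L * real n)"
  proof (rule exp_smallI[OF *(1,2)])
    fix n
    show "\<bar>x n - L * real n\<bar> \<le> (C + 2 * C / (1 - r)) * r ^ n"
    proof (cases "n = 0")
      case True
      then show ?thesis using * x0 by simp
    next
      case False
      then have n: "n \<ge> 1" by simp
      define R where "R = (\<Sum>m. ?t (m + n))"
      have "L = R + (\<Sum>m<n. ?t m)"
        unfolding L_def R_def by (rule suminf_split_initial_segment[OF summable])
      then have "x n - L * real n = \<rho> n - real n * R"
        using recurrence_solution[OF rec n] by (simp add: algebra_simps)
      moreover have "\<bar>R\<bar> \<le> 2 * C * r ^ n / real n * (1 / (1 - r))"
      proof -
        have "norm (?t (m + n)) \<le> 2 * C * r ^ (m + n) / real n" for m
          unfolding real_norm_def by (rule t[OF n]) simp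
        then have "norm (\<Sum>m. ?t (m + n)) \<le> (\<Sum>m. 2 * C * r ^ (m + n) / real n)"
          by (rule norm_suminf_le) (rule sums_summable[OF geo])
        then show ?thesis using geo[of n] by (simp add: sums_iff R_def)
      qed
      then have "real n * \<bar>R\<bar> \<le> real n * (2 * C * r ^ n / real n * (1 / (1 - r)))"
        by (rule mult_left_mono) simp
      then have "real n * \<bar>R\<bar> \<le> 2 * C / (1 - r) * r ^ n"
        using n by (simp add: mult_ac)
      ultimately show ?thesis
        using *(4)[rule_format, of n] abs_triangle_ineq4[of "\<rho> n" "real n * R"]
        by (simp add: abs_mult algebra_simps)
    qed
  qed
qed

section \<open>Mean and variance\<close>

abbreviation left :: "btree \<Rightarrow> btree" where "left \<equiv> Tree.left"
abbreviation right :: "btree \<Rightarrow> btree" where "right \<equiv> Tree.right"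

lemma sum_flip: "(\<Sum>i=1..<n::nat. f (n - i)) = (\<Sum>i=1..<n. f i :: 'a :: comm_monoid_add)"
  by (rule sum.reindex_bij_witness[where i = "\<lambda>i. n - i" and j = "\<lambda>i. n - i"]) auto

lemma bst_mean_left_right:
  fixes f g :: "btree \<Rightarrow> 'a :: real_algebra"
  assumes "n \<ge> 2"
  shows "bst_mean n (\<lambda>t. f (left t) * g (right t)) =
    (1 / (real n - 1)) *\<^sub>R (\<Sum>i=1..<n. bst_mean i f * bst_mean (n - i) g)"
  unfolding bst_mean_rec[OF assms] by (simp add: bst_mean_product)

lemma bst_mean_left:
  assumes "n \<ge> 2"
  shows "bst_mean n (\<lambda>t. f (left t)) = (1 / (real n - 1)) *\<^sub>R (\<Sum>i=1..<n. bst_mean i f)"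
  unfolding bst_mean_rec[OF assms]
  by (intro arg_cong2[where f = scaleR] refl sum.cong) (simp_all add: bst_mean_const Suc_le_eq)

lemma bst_mean_right:
  assumes "n \<ge> 2"
  shows "bst_mean n (\<lambda>t. f (right t)) = (1 / (real n - 1)) *\<^sub>R (\<Sum>i=1..<n. bst_mean i f)"
  unfolding bst_mean_rec[OF assms] sum_flip[of "\<lambda>i. bst_mean i f" n, symmetric]
  by (intro arg_cong2[where f = scaleR] refl sum.cong) (simp_all add: bst_mean_const Suc_le_eq)

text \<open>The contribution of the root to \<open>nsym\<close>. The leaf is excluded explicitly
  because the selectors return trees on it, too.\<close>

definition toll :: "btree \<Rightarrow> real" where
  "toll t = of_bool (t \<noteq> \<langle>\<rangle> \<and> isomorphic (left t) (right t))"

text \<open>The probability of a symmetrical root: the split into halves has probability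
  \<open>1 / (n - 1)\<close>, and two independent halves are isomorphic with probability
  \<open>class_moment 1 (n div 2)\<close>.\<close>

definition toll_mean :: "nat \<Rightarrow> real" where
  "toll_mean n = (if even n then class_moment 1 (n div 2) / (real n - 1) else 0)"

lemma bst_mean_toll: "n \<ge> 1 \<Longrightarrow> bst_mean n toll = toll_mean n"
proof (cases "n = 1")
  case True
  then show ?thesis unfolding True bst_mean_1 by (simp add: toll_def toll_mean_def)
next
  case False
  assume "n \<ge> 1"
  with False have n: "n \<ge> 2" by simp
  show ?thesis
    using bst_mean_isomorphic_split[of n "\<lambda>_. 1"]
    unfolding bst_mean_rec_real[OF n] by (simp add: toll_def toll_mean_def class_moment_def)
qed

lemma class_moment_size_0: "class_moment p 0 = 0"
  by (simp add: class_moment_def bst_mean_def size1_size)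

lemma toll_mean_nonneg: "0 \<le> toll_mean n"
  using class_moment_nonneg[of 1 "n div 2"] class_moment_size_0[of 1] by (cases "n = 0") (auto simp: toll_mean_def)

text \<open>A symmetrical root concerns trees of half the size, hence the square root of the rate in
  \<open>class_moment_1_le\<close>.\<close>

lemma exp_small_toll_mean: "exp_small toll_mean"
proof (rule exp_smallI[of "sqrt (53 / 100)"])
  fix n
  show "\<bar>toll_mean n\<bar> \<le> 12 * sqrt (53 / 100) ^ n"
  proof (cases "even n \<and> n \<noteq> 0")
    case True
    then obtain k where k: "n = 2 * k" "k \<ge> 1" by (auto elim: evenE)
    have "class_moment 1 k / (real n - 1) \<le> class_moment 1 k / 1"
      using k class_moment_nonneg[of 1 k] by (intro divide_left_mono) auto
    then have "\<bar>toll_mean n\<bar> \<le> class_moment 1 k / 1"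
      using k toll_mean_nonneg[of n] by (simp add: toll_mean_def)
    also have "\<dots> \<le> 12 * (53 / 100) ^ k" using class_moment_1_le[OF k(2)] by simp
    also have "(53 / 100) ^ k = sqrt (53 / 100) ^ n" by (simp add: k power_mult)
    finally show ?thesis .
  next
    case False
    then show ?thesis by (auto simp: toll_mean_def class_moment_size_0)
  qed
qed auto

definition nu :: real where "nu = suminf nu_term"

text \<open>Odd \<open>m\<close> contribute nothing, and at \<open>m = 2 * k\<close> the summand is
  \<open>nu_term k\<close>. This identifies the linear rate of the mean.\<close>

lemma sums_toll_mean: "(\<lambda>m. 2 * toll_mean m / (real m * (real m + 1))) sums nu"
proof -
  let ?f = "\<lambda>m. 2 * toll_mean m / (real m * (real m + 1))"
  have "?f (2 * k) = nu_term k" for k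
  proof (cases "k = 0")
    case False
    then have "2 * real k - 1 > 0" "2 * real k + 1 > 0" "real k > 0" by auto
    moreover have "2 * (c / a) / (2 * x * b) = c / (x * b * a)" if "a > 0" "b > 0" "x > 0" for a b c x :: real
      using that by (simp add: divide_simps)
    ultimately show ?thesis using False
      by (simp add: nu_term_eq Suc_le_eq toll_mean_def)
  qed simp
  then have "(\<lambda>k. ?f (2 * k)) sums nu"
    using summable_nu_term by (simp add: nu_def summable_sums)
  moreover have "strict_mono (\<lambda>k::nat. 2 * k)" by (auto intro: strict_monoI)
  ultimately show ?thesis
    by (subst (asm) sums_mono_reindex) (auto simp: toll_mean_def elim!: evenE)
qed

lemma nu_nonneg: "0 \<le> nu"
  unfolding nu_def using summable_nu_term nu_term_nonneg by (intro suminf_nonneg)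

section \<open>The centred functional and its mean\<close>

text \<open>The number of leaves is additive over the subtrees, so this centring leaves the toll
  unchanged while the mean becomes exponentially small.\<close>

definition excess :: "btree \<Rightarrow> real" where
  "excess t = real (nsym t) - nu * real (size1 t)"

definition subexcess :: "btree \<Rightarrow> real" where
  "subexcess t = excess (left t) + excess (right t)"

lemma excess_eq: "t \<noteq> \<langle>\<rangle> \<Longrightarrow> excess t = subexcess t + toll t"
  by (cases t) (auto simp: excess_def subexcess_def toll_def algebra_simps)

lemma size1_ge_2D: "size1 t = n \<Longrightarrow> n \<ge> 2 \<Longrightarrow> t \<noteq> \<langle>\<rangle>"
  by auto

lemma nsym_le: "nsym t \<le> size1 t - 1"
proof (induction t)
  case (Node l x r)
  then show ?case using size1_ge_1[of l] size1_ge_1[of r] by auto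
qed simp

lemma abs_excess_le: "\<bar>excess t\<bar> \<le> (1 + nu) * real (size1 t)"
proof -
  have "real (nsym t) \<le> real (size1 t)" using nsym_le[of t] by simp
  moreover have "0 \<le> nu * real (size1 t)" using nu_nonneg by simp
  ultimately show ?thesis by (simp add: excess_def abs_le_iff algebra_simps)
qed

lemma abs_subexcess_le: "t \<noteq> \<langle>\<rangle> \<Longrightarrow> \<bar>subexcess t\<bar> \<le> (1 + nu) * real (size1 t)"
  using abs_excess_le[of "left t"] abs_excess_le[of "right t"]
  by (cases t) (auto simp: subexcess_def algebra_simps)

definition delta :: "nat \<Rightarrow> real" where "delta n = bst_mean n excess"

lemma bst_mean_0 [simp]: "bst_mean 0 f = 0"
  by (simp add: bst_mean_def size1_size)

lemma bst_mean_subexcess: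
  assumes "n \<ge> 2"
  shows "bst_mean n subexcess = 2 / (real n - 1) * (\<Sum>i=1..<n. delta i)"
proof -
  have "bst_mean n subexcess = bst_mean n (\<lambda>t. excess (left t)) + bst_mean n (\<lambda>t. excess (right t))"
    unfolding bst_mean_add[symmetric] by (intro bst_mean_cong) (simp add: subexcess_def)
  then show ?thesis
    unfolding bst_mean_left[OF assms] bst_mean_right[OF assms] by (simp add: delta_def)
qed

lemma delta_rec:
  assumes "n \<ge> 2"
  shows "delta n = 2 / (real n - 1) * (\<Sum>i=1..<n. delta i) + toll_mean n"
proof -
  have "delta n = bst_mean n (\<lambda>t. subexcess t + toll t)"
    unfolding delta_def using assms by (intro bst_mean_cong excess_eq size1_ge_2D)
  then show ?thesis using assms by (simp add: bst_mean_add bst_mean_subexcess bst_mean_toll)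
qed

lemma sum_of_nat_interval: "2 * (\<Sum>i=1..<n. real i) = real n * (real n - 1)"
  by (induction n) (auto simp: algebra_simps)

lemma exp_small_delta: "exp_small delta"
proof -
  \<comment> \<open>Adding the linear part back gives the mean of \<open>nsym\<close>, whose
    inhomogeneous term is \<open>toll_mean\<close> at \<open>n = 1\<close> as well; its linear rate
    is \<open>nu\<close> by \<open>sums_toll_mean\<close>.\<close>
  let ?m = "\<lambda>n. delta n + nu * real n"
  have rec: "?m n = 2 / (real n - 1) * (\<Sum>i=1..<n. ?m i) + toll_mean n" if "n \<ge> 1" for n
  proof (cases "n = 1")
    case True
    have "delta 1 = - nu" unfolding delta_def bst_mean_1 by (simp add: excess_def)
    then show ?thesis using True by (simp add: toll_mean_def)
  next
    case False
    then have n: "n \<ge> 2" using that by simp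
    have "2 / (real n - 1) * (\<Sum>i=1..<n. ?m i) =
        2 / (real n - 1) * (\<Sum>i=1..<n. delta i) + nu / (real n - 1) * (2 * (\<Sum>i=1..<n. real i))"
      by (simp add: sum.distrib sum_distrib_left ring_distribs mult_ac)
    also have "nu / (real n - 1) * (2 * (\<Sum>i=1..<n. real i)) = nu * real n"
      unfolding sum_of_nat_interval using n by simp
    finally show ?thesis using delta_rec[OF n] by simp
  qed
  have "exp_small (\<lambda>n. ?m n - (\<Sum>m. 2 * toll_mean m / (real m * (real m + 1))) * real n)"
    by (rule recurrence_asymptotics(2)[OF rec exp_small_toll_mean]) (simp_all add: delta_def)
  then show ?thesis using sums_toll_mean by (simp add: sums_iff)
qed

section \<open>The second moment and its linear rate\<close>

definition moment2 :: "nat \<Rightarrow> real" where "moment2 n = bst_mean n (\<lambda>t. (excess t)\<^sup>2)"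

definition moment2_toll :: "nat \<Rightarrow> real" where
  "moment2_toll n = bst_mean n (\<lambda>t. (excess t)\<^sup>2 - (subexcess t)\<^sup>2)"

definition delta_conv :: "nat \<Rightarrow> real" where
  "delta_conv n = 2 / (real n - 1) * (\<Sum>i=1..<n. delta i * delta (n - i))"

lemma bst_mean_subexcess2:
  assumes "n \<ge> 2"
  shows "bst_mean n (\<lambda>t. (subexcess t)\<^sup>2) = 2 / (real n - 1) * (\<Sum>i=1..<n. moment2 i) + delta_conv n"
proof -
  have "bst_mean n (\<lambda>t. (subexcess t)\<^sup>2) = bst_mean n (\<lambda>t. (excess (left t))\<^sup>2) +
      bst_mean n (\<lambda>t. (excess (right t))\<^sup>2) + 2 * bst_mean n (\<lambda>t. excess (left t) * excess (right t))"
    unfolding bst_mean_mult_left[symmetric] bst_mean_add[symmetric]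
    by (simp add: subexcess_def power2_sum mult.assoc)
  then show ?thesis
    unfolding bst_mean_left[OF assms, of "\<lambda>t. (excess t)\<^sup>2"] bst_mean_right[OF assms, of "\<lambda>t. (excess t)\<^sup>2"]
      bst_mean_left_right[OF assms]
    by (simp add: moment2_def delta_conv_def delta_def)
qed

lemma moment2_rec:
  assumes "n \<ge> 2"
  shows "moment2 n = 2 / (real n - 1) * (\<Sum>i=1..<n. moment2 i) + (delta_conv n + moment2_toll n)"
  using bst_mean_subexcess2[OF assms] by (simp add: moment2_toll_def bst_mean_diff moment2_def)

text \<open>The difference of squares is zero unless the root is symmetrical; there it equals
  \<open>excess t + subexcess t\<close>, which is at most linear in \<open>n\<close>.\<close>

lemma abs_moment2_toll_le:
  assumes "n \<ge> 2"
  shows "\<bar>moment2_toll n\<bar> \<le> 2 * (1 + nu) * (real n * toll_mean n)"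
proof -
  have "\<bar>moment2_toll n\<bar> \<le> bst_mean n (\<lambda>t. \<bar>(excess t)\<^sup>2 - (subexcess t)\<^sup>2\<bar>)"
    unfolding moment2_toll_def using norm_bst_mean_le[of n "\<lambda>t. (excess t)\<^sup>2 - (subexcess t)\<^sup>2"] by simp
  also have "\<dots> \<le> bst_mean n (\<lambda>t. 2 * (1 + nu) * real n * toll t)"
  proof (rule bst_mean_mono)
    fix t :: btree assume t: "size1 t = n"
    then have nl: "t \<noteq> \<langle>\<rangle>" using assms by auto
    show "\<bar>(excess t)\<^sup>2 - (subexcess t)\<^sup>2\<bar> \<le> 2 * (1 + nu) * real n * toll t"
    proof (cases "toll t = 0")
      case True
      then show ?thesis using excess_eq[OF nl] by simp
    next
      case False
      then have toll: "toll t = 1" by (simp add: toll_def)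
      have "\<bar>(excess t)\<^sup>2 - (subexcess t)\<^sup>2\<bar> = \<bar>excess t + subexcess t\<bar>"
        using excess_eq[OF nl] toll by (simp add: power2_eq_square algebra_simps)
      also have "\<dots> \<le> 2 * (1 + nu) * real n"
        using abs_triangle_ineq[of "excess t" "subexcess t"] abs_excess_le[of t] abs_subexcess_le[OF nl]
        by (simp add: t algebra_simps)
      finally show ?thesis using toll by simp
    qed
  qed
  also have "\<dots> = 2 * (1 + nu) * (real n * toll_mean n)"
    using assms by (simp add: bst_mean_mult_left bst_mean_toll)
  finally show ?thesis .
qed

lemma exp_small_of_bool: "exp_small (\<lambda>n. of_bool (n = 1))"
  by (rule exp_smallI[of "1/2" _ 2]) auto

text \<open>Taking the inhomogeneous term as a difference makes the recurrence hold by definition;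
  at \<open>n = 1\<close> division by zero reduces it to \<open>moment2 1\<close>.\<close>

definition moment2_defect :: "nat \<Rightarrow> real" where
  "moment2_defect n = moment2 n - 2 / (real n - 1) * (\<Sum>i=1..<n. moment2 i)"

lemma exp_small_moment2_defect: "exp_small moment2_defect"
proof -
  \<comment> \<open>The three parts majorize the products of the subtree means, the toll and the
    initial value.\<close>
  define B where "B n = 2 * \<bar>\<Sum>i=1..<n. delta i * delta (n - i)\<bar> +
    (2 * (1 + nu) * (real n * toll_mean n) + moment2 1 * of_bool (n = 1))" for n
  have m1: "0 \<le> moment2 1" unfolding moment2_def by (rule bst_mean_nonneg) simp
  have "exp_small B"
    unfolding B_def
    by (intro exp_small_add exp_small_cmult exp_small_of_bool exp_small_mono[OF exp_small_convolution[OF exp_small_delta exp_small_delta]]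
        exp_small_of_nat_mult exp_small_toll_mean) simp
  then show ?thesis
  proof (rule exp_small_mono)
    fix n
    have B: "0 \<le> 2 * \<bar>\<Sum>i=1..<n. delta i * delta (n - i)\<bar>" "0 \<le> 2 * (1 + nu) * (real n * toll_mean n)"
      using nu_nonneg toll_mean_nonneg by auto
    consider "n = 0" | "n = 1" | "n \<ge> 2" by linarith
    then have "\<bar>moment2_defect n\<bar> \<le> B n"
    proof cases
      case 1
      then show ?thesis by (simp add: moment2_defect_def B_def moment2_def)
    next
      case 2
      then show ?thesis using m1 nu_nonneg toll_mean_nonneg[of 1] by (simp add: moment2_defect_def B_def)
    next
      case 3
      have "\<bar>delta_conv n\<bar> \<le> 2 * \<bar>\<Sum>i=1..<n. delta i * delta (n - i)\<bar>"
        using 3 mult_right_mono[of "2 / (real n - 1)" 2 "\<bar>\<Sum>i=1..<n. delta i * delta (n - i)\<bar>"]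
        by (simp add: delta_conv_def abs_mult field_simps)
      moreover have "moment2_defect n = delta_conv n + moment2_toll n"
        using moment2_rec[OF 3] by (simp add: moment2_defect_def)
      ultimately show ?thesis
        using abs_moment2_toll_le[OF 3] 3 by (simp add: B_def)
    qed
    then show "\<bar>moment2_defect n\<bar> \<le> \<bar>B n\<bar>" by linarith
  qed
qed

text \<open>The variance differs from \<open>moment2\<close> only by
  \<open>(delta n)\<^sup>2\<close>, which is exponentially small, so the linear rate of the second
  moment is that of the variance.\<close>

definition variance_rate :: real where
  "variance_rate = (\<Sum>m. 2 * moment2_defect m / (real m * (real m + 1)))"

definition moment2_excess :: "nat \<Rightarrow> real" where
  "moment2_excess n = moment2 n - variance_rate * real n"

lemma exp_small_moment2_excess: "exp_small moment2_excess"
  unfolding moment2_excess_def variance_rate_def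
  by (rule recurrence_asymptotics(2)[OF _ exp_small_moment2_defect])
    (simp_all add: moment2_defect_def moment2_def)

section \<open>Positivity of the variance rate\<close>

lemma bst_mean_2: "bst_mean 2 f = f \<langle>\<langle>\<rangle>, (), \<langle>\<rangle>\<rangle>"
proof -
  have "{1..<2} = {1::nat}" by auto
  then show ?thesis by (simp add: bst_mean_rec bst_mean_1[unfolded One_nat_def] bst_mean_1 del: One_nat_def)
qed

lemma bst_mean_3:
  "bst_mean 3 f = (1 / 2) *\<^sub>R (f \<langle>\<langle>\<rangle>, (), \<langle>\<langle>\<rangle>, (), \<langle>\<rangle>\<rangle>\<rangle> + f \<langle>\<langle>\<langle>\<rangle>, (), \<langle>\<rangle>\<rangle>, (), \<langle>\<rangle>\<rangle>)"
proof -
  have "{1..<3} = {1, 2::nat}" by auto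
  then show ?thesis by (simp add: bst_mean_rec[of 3] bst_mean_1[unfolded One_nat_def] bst_mean_1 bst_mean_2 del: One_nat_def)
qed

text \<open>Four is the smallest size at which \<open>nsym\<close> is not constant: it is 1 with
  probability 2/3 and 3 for the balanced tree. Its variance 8/9 bounds the second moment about any
  point, so \<open>x\<close> can stand for the rest of the tree.\<close>

lemma bst_mean_4_excess: "bst_mean 4 (\<lambda>t. (excess t + x)\<^sup>2) \<ge> 8 / 9"
proof -
  define y where "y = x - 4 * nu + 1"
  have "{1..<4} = {1, 2, 3::nat}" by auto
  then have "bst_mean 4 (\<lambda>t. (excess t + x)\<^sup>2) = 2 / 3 * y\<^sup>2 + 1 / 3 * (y + 2)\<^sup>2"
    by (simp add: bst_mean_rec[of 4] bst_mean_1[unfolded One_nat_def] bst_mean_1 bst_mean_2 bst_mean_3 excess_def y_def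
        algebra_simps del: One_nat_def)
  also have "\<dots> = (y + 2 / 3)\<^sup>2 + 8 / 9" by (simp add: power2_eq_square field_simps)
  finally show ?thesis by simp
qed

text \<open>The left subtree has four leaves with probability \<open>1/(n-1)\<close>, and it is then still random.\<close>

lemma moment2_ge:
  assumes "n \<ge> 9"
  shows "moment2 n \<ge> 8 / 9 / real n"
proof -
  have n: "n \<ge> 2" using assms by simp
  let ?h = "\<lambda>i. bst_mean i (\<lambda>l. bst_mean (n - i) (\<lambda>r. (excess \<langle>l, (), r\<rangle>)\<^sup>2))"
  have "8 / 9 \<le> ?h 4"
  proof -
    have "8 / 9 = bst_mean (n - 4) (\<lambda>_. 8 / 9 :: real)" using assms by (simp add: bst_mean_const)
    also have "\<dots> \<le> bst_mean (n - 4) (\<lambda>r. bst_mean 4 (\<lambda>l. (excess l + excess r)\<^sup>2))"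
      by (intro bst_mean_mono bst_mean_4_excess)
    also have "\<dots> = bst_mean 4 (\<lambda>l. bst_mean (n - 4) (\<lambda>r. (excess l + excess r)\<^sup>2))"
      unfolding bst_mean_def real_scaleR_def sum_distrib_left by (subst sum.swap) (simp add: mult_ac)
    also have "\<dots> = ?h 4"
    proof (intro bst_mean_cong arg_cong[where f = "\<lambda>x. x\<^sup>2"])
      fix l r :: btree assume "size1 l = 4" "size1 r = n - 4"
      \<comment> \<open>At least five leaves remain on the right, so the root is not symmetrical and
        adds no toll.\<close>
      then have "\<not> isomorphic l r" using assms isomorphic_size1[of l r] by auto
      then show "excess l + excess r = excess \<langle>l, (), r\<rangle>"
        by (simp add: excess_def algebra_simps)
    qed
    finally show ?thesis .
  qed
  also have "?h 4 \<le> (\<Sum>i=1..<n. ?h i)"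
    using assms by (intro member_le_sum) (auto intro!: bst_mean_nonneg)
  finally have "8 / 9 / real n \<le> (\<Sum>i=1..<n. ?h i) / (real n - 1)"
    using assms by (intro frac_le) auto
  then show ?thesis unfolding moment2_def bst_mean_rec_real[OF n] .
qed

lemma variance_rate_pos: "0 < variance_rate"
proof (rule ccontr)
  assume neg: "\<not> 0 < variance_rate"
  have "(\<lambda>n. real n * moment2_excess n) \<longlonglongrightarrow> 0"
    by (intro exp_small_tendsto_0 exp_small_of_nat_mult exp_small_moment2_excess)
  then have "eventually (\<lambda>n. real n * moment2_excess n < 8 / 9) sequentially"
    by (rule order_tendstoD) simp
  then have "eventually (\<lambda>n. real n * moment2_excess n < 8 / 9 \<and> n \<ge> 9) sequentially"
    using eventually_ge_at_top by (rule eventually_conj)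
  then obtain n where n: "real n * moment2_excess n < 8 / 9" "n \<ge> 9"
    by (auto simp: eventually_at_top_linorder)
  \<comment> \<open>With a rate that is not positive, the exponential smallness of
    \<open>moment2_excess\<close> would pass to \<open>moment2\<close>.\<close>
  have "moment2 n \<le> moment2_excess n"
    using neg by (simp add: moment2_excess_def mult_nonpos_nonneg)
  then have "8 / 9 / real n \<le> moment2_excess n" using moment2_ge[OF n(2)] by linarith
  then show False using n by (simp add: field_simps)
qed

section \<open>Characteristic functions\<close>

lemma cmod_cis_taylor:
  "cmod (cis x - (1 + \<i> * of_real x - of_real (x\<^sup>2 / 2))) \<le> \<bar>x\<bar> ^ 3 / 6"
proof -
  have "{..2} = {0, 1, 2 :: nat}" by auto
  then have "(\<Sum>k\<le>2. (\<i> * of_real x) ^ k / fact k) = 1 + \<i> * of_real x - complex_of_real (x\<^sup>2 / 2)"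
    by (simp add: power_mult_distrib)
  then show ?thesis
    using iexp_approx1[of x 2] by (simp add: cis_conv_exp fact_numeral)
qed

text \<open>The exponent carries \<open>b - a\<^sup>2\<close>, as in a cumulant expansion: the
  square of the linear term contributes \<open>- t\<^sup>2 / 2 * a\<^sup>2\<close>, which leaves
  \<open>b\<close> at second order. One constant serves all bounded \<open>a\<close> and
  \<open>b\<close>.\<close>

lemma exp_second_order:
  fixes M :: real
  obtains C where "0 \<le> C" "\<forall>t a b. \<bar>t\<bar> \<le> 1 \<longrightarrow> \<bar>a\<bar> \<le> M \<longrightarrow> \<bar>b\<bar> \<le> M \<longrightarrow>
    cmod (exp (\<i> * of_real (t * a) - of_real (t\<^sup>2 / 2 * (b - a\<^sup>2))) -
      (1 + \<i> * of_real (t * a) - of_real (t\<^sup>2 / 2 * b))) \<le> C * \<bar>t\<bar> ^ 3"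
proof (cases "0 \<le> M")
  case False
  then show ?thesis by (intro that[of 0]) auto
next
  case M: True
  \<comment> \<open>Since \<open>t\<^sup>2 \<le> \<bar>t\<bar>\<close>, the modulus of the exponent
    is at most \<open>\<bar>t\<bar>\<close> times \<open>M + (M + M\<^sup>2)\<close>.\<close>
  define B where "B = 2 * M + M\<^sup>2"
  have B: "0 \<le> B" "M \<le> B" using M by (auto simp: B_def)
  define C where "C = exp B * B ^ 3 / 2 + B\<^sup>2 + B\<^sup>2"
  show ?thesis
  proof (rule that[of C], safe)
    show "0 \<le> C" using B by (simp add: C_def)
  next
    fix t a b :: real assume t: "\<bar>t\<bar> \<le> 1" and a: "\<bar>a\<bar> \<le> M" and b: "\<bar>b\<bar> \<le> M"
    define w where "w = b - a\<^sup>2"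
    define z where "z = \<i> * of_real (t * a) - complex_of_real (t\<^sup>2 / 2 * w)"
    have t2: "t\<^sup>2 \<le> \<bar>t\<bar>" using mult_left_le[of "\<bar>t\<bar>" "\<bar>t\<bar>"] t by (simp add: power2_eq_square)
    have t4: "t ^ 4 \<le> \<bar>t\<bar> ^ 3"
      using power_decreasing[of 3 4 "\<bar>t\<bar>"] t by simp
    have a2: "a\<^sup>2 \<le> M\<^sup>2" using a M abs_le_square_iff[of a M] by simp
    have w: "\<bar>w\<bar> \<le> M + M\<^sup>2" using a2 b zero_le_power2[of a] unfolding w_def by linarith
    then have wB: "\<bar>w\<bar> \<le> B" using M by (simp add: B_def)
    have "cmod z \<le> \<bar>t\<bar> * \<bar>a\<bar> + t\<^sup>2 / 2 * \<bar>w\<bar>"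
      unfolding z_def by (rule order.trans[OF norm_triangle_ineq4]) (simp add: norm_mult abs_mult norm_power)
    also have "\<dots> \<le> \<bar>t\<bar> * M + \<bar>t\<bar> * (M + M\<^sup>2)"
      using a w t2 by (intro add_mono mult_mono mult_left_mono) auto
    also have "\<dots> = \<bar>t\<bar> * B" by (simp add: B_def algebra_simps)
    finally have z: "cmod z \<le> \<bar>t\<bar> * B" .
    also have "\<dots> \<le> B" using t B by (simp add: mult_left_le_one_le)
    finally have zB: "\<bar>Re z\<bar> \<le> B" using abs_Re_le_cmod[of z] by linarith
    have "{..2} = {0, 1, 2 :: nat}" by auto
    then have sum: "(\<Sum>k\<le>2. z ^ k / fact k) = 1 + z + z\<^sup>2 / 2" by simp
    have "cmod (exp z - (1 + z + z\<^sup>2 / 2)) \<le> exp \<bar>Re z\<bar> * cmod z ^ 3 / 2"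
      using Taylor_exp[of z 2] unfolding sum by (simp add: eval_nat_numeral)
    also have "\<dots> \<le> exp B * (\<bar>t\<bar> * B) ^ 3 / 2"
      using z zB B by (intro divide_right_mono mult_mono power_mono) auto
    finally have 1: "cmod (exp z - (1 + z + z\<^sup>2 / 2)) \<le> (exp B * B ^ 3 / 2) * \<bar>t\<bar> ^ 3"
      by (simp add: power_mult_distrib mult_ac)
    have "(1 + z + z\<^sup>2 / 2) - (1 + \<i> * of_real (t * a) - of_real (t\<^sup>2 / 2 * b)) =
        of_real (t ^ 4 * w\<^sup>2 / 8) - \<i> * of_real (t ^ 3 * a * w / 2)"
      by (simp add: z_def w_def complex_eq_iff power2_eq_square eval_nat_numeral field_simps)
    also have "cmod \<dots> \<le> t ^ 4 * w\<^sup>2 / 8 + \<bar>t\<bar> ^ 3 * \<bar>a\<bar> * \<bar>w\<bar> / 2"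
      by (rule order.trans[OF norm_triangle_ineq4]) (simp add: norm_mult norm_divide norm_power power_abs abs_mult)
    also have "\<dots> \<le> \<bar>t\<bar> ^ 3 * B\<^sup>2 + \<bar>t\<bar> ^ 3 * B * B"
    proof (rule add_mono)
      have "w\<^sup>2 \<le> B\<^sup>2" using wB B abs_le_square_iff[of w B] by simp
      then have "t ^ 4 * w\<^sup>2 \<le> \<bar>t\<bar> ^ 3 * B\<^sup>2" using t4 by (intro mult_mono) auto
      moreover have "0 \<le> t ^ 4 * w\<^sup>2" by simp
      ultimately show "t ^ 4 * w\<^sup>2 / 8 \<le> \<bar>t\<bar> ^ 3 * B\<^sup>2" by linarith
      have "\<bar>t\<bar> ^ 3 * \<bar>a\<bar> * \<bar>w\<bar> \<le> \<bar>t\<bar> ^ 3 * B * B"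
        using a wB B by (intro mult_mono mult_left_mono) auto
      moreover have "0 \<le> \<bar>t\<bar> ^ 3 * \<bar>a\<bar> * \<bar>w\<bar>" by simp
      ultimately show "\<bar>t\<bar> ^ 3 * \<bar>a\<bar> * \<bar>w\<bar> / 2 \<le> \<bar>t\<bar> ^ 3 * B * B" by linarith
    qed
    finally have 2: "cmod ((1 + z + z\<^sup>2 / 2) - (1 + \<i> * of_real (t * a) - of_real (t\<^sup>2 / 2 * b)))
        \<le> (B\<^sup>2 + B\<^sup>2) * \<bar>t\<bar> ^ 3"
      by (simp add: algebra_simps power2_eq_square)
    have "cmod (exp z - (1 + \<i> * of_real (t * a) - of_real (t\<^sup>2 / 2 * b))) \<le> C * \<bar>t\<bar> ^ 3"
      using norm_diff_triangle_le[OF 1 2] unfolding C_def by (simp only: distrib_right add.assoc)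
    then show "cmod (exp (\<i> * of_real (t * a) - of_real (t\<^sup>2 / 2 * (b - a\<^sup>2))) -
      (1 + \<i> * of_real (t * a) - of_real (t\<^sup>2 / 2 * b))) \<le> C * \<bar>t\<bar> ^ 3"
      by (simp only: z_def w_def)
  qed
qed

lemma abs_power3: "\<bar>x\<bar> ^ 3 = x\<^sup>2 * \<bar>x :: real\<bar>"
  by (simp add: power3_eq_cube power2_eq_square)

text \<open>The average over the uniformly distributed split at the root, as it occurs in the
  recurrence of the characteristic functions.\<close>

definition split_avg :: "nat \<Rightarrow> (nat \<Rightarrow> nat \<Rightarrow> complex) \<Rightarrow> complex" where
  "split_avg n f = (1 / (real n - 1)) *\<^sub>R (\<Sum>i=1..<n. f i (n - i))"

lemma split_avg_bound:
  assumes "n \<ge> 2" "\<And>i j. 1 \<le> i \<Longrightarrow> 1 \<le> j \<Longrightarrow> i + j = n \<Longrightarrow> cmod (f i j) \<le> c"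
  shows "cmod (split_avg n f) \<le> c"
proof -
  have "cmod (\<Sum>i=1..<n. f i (n - i)) \<le> (\<Sum>i=1..<n. c)"
    using assms(2) by (intro order.trans[OF norm_sum] sum_mono) auto
  also have "\<dots> = (real n - 1) * c" using assms(1) by (simp add: of_nat_diff)
  finally have "cmod (\<Sum>i=1..<n. f i (n - i)) / (real n - 1) \<le> (real n - 1) * c / (real n - 1)"
    using assms(1) by (intro divide_right_mono) auto
  then show ?thesis using assms(1) by (simp add: split_avg_def)
qed

lemma split_avg_diff: "split_avg n f - split_avg n g = split_avg n (\<lambda>i j. f i j - g i j)"
  by (simp add: split_avg_def sum_subtractf scaleR_diff_right)

definition char_fun :: "real \<Rightarrow> nat \<Rightarrow> complex" where
  "char_fun t n = bst_mean n (\<lambda>T. cis (t * excess T))"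

text \<open>The logarithm of the characteristic function of the normal law with the mean and the
  variance of \<open>excess\<close> at size \<open>n\<close>.\<close>

definition gauss_exponent :: "real \<Rightarrow> nat \<Rightarrow> complex" where
  "gauss_exponent t n = \<i> * of_real (t * delta n) - of_real (t\<^sup>2 / 2 * (moment2 n - (delta n)\<^sup>2))"

text \<open>
  Without the factor that is geometric in \<open>n\<close>, which the recurrence reproduces exactly; what is left
  has bounded parameters.
\<close>

definition gauss_factor :: "real \<Rightarrow> nat \<Rightarrow> complex" where
  "gauss_factor t n = exp (\<i> * of_real (t * delta n) - of_real (t\<^sup>2 / 2 * (moment2_excess n - (delta n)\<^sup>2)))"

text \<open>The first and second order terms contributed by the toll at the root.\<close>

definition toll_term :: "real \<Rightarrow> nat \<Rightarrow> complex" where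
  "toll_term t n = \<i> * of_real (t * toll_mean n) - of_real (t\<^sup>2 / 2 * moment2_toll n)"

lemma split_avg_char_fun:
  assumes "n \<ge> 2"
  shows "split_avg n (\<lambda>i j. char_fun t i * char_fun t j) = bst_mean n (\<lambda>T. cis (t * subexcess T))"
  unfolding split_avg_def char_fun_def bst_mean_left_right[OF assms, symmetric]
  by (simp add: subexcess_def cis_mult ring_distribs)

text \<open>Only trees with a symmetrical root are affected by the toll. Their Taylor error is of
  order \<open>(n * \<bar>t\<bar>) ^ 3\<close>, but their probability \<open>toll_mean n\<close> is
  exponentially small and absorbs \<open>n ^ 3\<close>, so the bound is uniform in
  \<open>n\<close>.\<close>

lemma char_fun_split:
  obtains C where "0 \<le> C" "\<forall>t n. n \<ge> 2 \<longrightarrow>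
    cmod (char_fun t n - split_avg n (\<lambda>i j. char_fun t i * char_fun t j) - toll_term t n) \<le> C * \<bar>t\<bar> ^ 3"
proof -
  obtain K where K: "0 \<le> K" "\<forall>n. \<bar>real n ^ 3 * toll_mean n\<bar> \<le> K"
    by (rule exp_small_bounded[OF exp_small_power_mult[OF exp_small_toll_mean]])
  show ?thesis
  proof (rule that[of "(1 + nu) ^ 3 * K"], safe)
    show "0 \<le> (1 + nu) ^ 3 * K" using K nu_nonneg by simp
  next
    fix t :: real and n :: nat assume n: "n \<ge> 2"
    let ?g = "\<lambda>x. cis x - (1 + \<i> * of_real x - of_real (x\<^sup>2 / 2))"
    let ?h = "\<lambda>T. ?g (t * excess T) - ?g (t * subexcess T)"
    have mean: "bst_mean n (\<lambda>T. \<i> * of_real (f T) - of_real (g T)) =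
        \<i> * of_real (bst_mean n f) - complex_of_real (bst_mean n g)" for f g
      by (simp only: bst_mean_diff bst_mean_mult_left bst_mean_of_real)
    have "toll_term t n = bst_mean n (\<lambda>T. \<i> * of_real (t * toll T) - of_real (t\<^sup>2 / 2 * ((excess T)\<^sup>2 - (subexcess T)\<^sup>2)))"
      using n unfolding mean by (simp only: toll_term_def bst_mean_mult_left moment2_toll_def bst_mean_toll)
    then have "char_fun t n - split_avg n (\<lambda>i j. char_fun t i * char_fun t j) - toll_term t n =
      bst_mean n (\<lambda>T. cis (t * excess T) - cis (t * subexcess T) -
        (\<i> * of_real (t * toll T) - of_real (t\<^sup>2 / 2 * ((excess T)\<^sup>2 - (subexcess T)\<^sup>2))))"
      unfolding split_avg_char_fun[OF n] by (simp only: char_fun_def bst_mean_diff)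
    also have "\<dots> = bst_mean n ?h"
    proof (rule bst_mean_cong)
      fix T :: btree assume "size1 T = n"
      then have toll: "toll T = excess T - subexcess T" using excess_eq[OF size1_ge_2D, of T n] n by simp
      show "cis (t * excess T) - cis (t * subexcess T) -
        (\<i> * of_real (t * toll T) - of_real (t\<^sup>2 / 2 * ((excess T)\<^sup>2 - (subexcess T)\<^sup>2))) = ?h T"
        unfolding toll by (simp add: complex_eq_iff power_mult_distrib right_diff_distrib diff_divide_distrib)
    qed
    finally have "cmod (char_fun t n - split_avg n (\<lambda>i j. char_fun t i * char_fun t j) - toll_term t n) =
      cmod (bst_mean n ?h)" by (rule arg_cong)
    also have "\<dots> \<le> bst_mean n (\<lambda>T. (1 + nu) ^ 3 * real n ^ 3 * \<bar>t\<bar> ^ 3 * toll T)"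
    proof (rule order.trans[OF norm_bst_mean_le bst_mean_mono])
      fix T :: btree assume T: "size1 T = n"
      then have nl: "T \<noteq> \<langle>\<rangle>" using n by auto
      show "cmod (?h T) \<le> (1 + nu) ^ 3 * real n ^ 3 * \<bar>t\<bar> ^ 3 * toll T"
      proof (cases "toll T = 0")
        case True
        then show ?thesis using excess_eq[OF nl] by simp
      next
        case False
        then have toll: "toll T = 1" by (simp add: toll_def)
        define Y where "Y = (1 + nu) ^ 3 * real n ^ 3 * \<bar>t\<bar> ^ 3"
        have Y: "0 \<le> Y" using nu_nonneg by (simp add: Y_def)
        have *: "cmod (?g (t * x)) \<le> Y / 6" if "\<bar>x\<bar> \<le> (1 + nu) * real n" for x
        proof -
          have "\<bar>t * x\<bar> ^ 3 \<le> (\<bar>t\<bar> * ((1 + nu) * real n)) ^ 3"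
            unfolding abs_mult using that by (intro power_mono mult_left_mono) auto
          also have "\<dots> = Y" by (simp add: Y_def power_mult_distrib mult_ac)
          finally show ?thesis using cmod_cis_taylor[of "t * x"] by linarith
        qed
        have "cmod (?h T) \<le> Y / 6 + Y / 6"
          using abs_excess_le[of T] abs_subexcess_le[OF nl] T
          by (intro order.trans[OF norm_triangle_ineq4 add_mono[OF * *]]) auto
        also have "\<dots> \<le> Y" using Y by simp
        finally show ?thesis by (simp add: toll Y_def)
      qed
    qed
    also have "\<dots> = (1 + nu) ^ 3 * \<bar>t\<bar> ^ 3 * (real n ^ 3 * toll_mean n)"
    proof -
      have mean_toll: "bst_mean n toll = toll_mean n" using n by (intro bst_mean_toll) simp
      show ?thesis unfolding bst_mean_mult_left mean_toll by (simp only: mult_ac)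
    qed
    also have "\<dots> \<le> (1 + nu) ^ 3 * \<bar>t\<bar> ^ 3 * K"
      using K(2)[rule_format, of n] nu_nonneg by (intro mult_left_mono) auto
    finally show "cmod (char_fun t n - split_avg n (\<lambda>i j. char_fun t i * char_fun t j) - toll_term t n)
      \<le> (1 + nu) ^ 3 * K * \<bar>t\<bar> ^ 3" by (simp add: mult_ac)
  qed
qed

lemma moment2_excess_rec:
  assumes "n \<ge> 2"
  shows "moment2_excess n = 2 / (real n - 1) * (\<Sum>i=1..<n. moment2_excess i) + (delta_conv n + moment2_toll n)"
proof -
  have "2 / (real n - 1) * (\<Sum>i=1..<n. moment2_excess i) =
      2 / (real n - 1) * (\<Sum>i=1..<n. moment2 i) - variance_rate / (real n - 1) * (2 * (\<Sum>i=1..<n. real i))"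
    by (simp add: moment2_excess_def sum_subtractf sum_distrib_left right_diff_distrib mult_ac)
  also have "variance_rate / (real n - 1) * (2 * (\<Sum>i=1..<n. real i)) = variance_rate * real n"
    unfolding sum_of_nat_interval using assms by simp
  finally show ?thesis using moment2_rec[OF assms] by (simp add: moment2_excess_def)
qed

text \<open>As \<open>delta\<close> and \<open>moment2_excess\<close> are bounded, second-order
  expansions have a uniform cubic error. Their coefficients satisfy the recurrences of the moments,
  so the tolls of these recurrences are all that remains.\<close>

lemma gauss_factor_split:
  obtains C where "0 \<le> C" "\<forall>t n. n \<ge> 2 \<longrightarrow> \<bar>t\<bar> \<le> 1 \<longrightarrow>
    cmod (gauss_factor t n - split_avg n (\<lambda>i j. gauss_factor t i * gauss_factor t j) - toll_term t n) \<le> C * \<bar>t\<bar> ^ 3"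
proof -
  obtain M1 where M1: "0 \<le> M1" "\<forall>n. \<bar>delta n\<bar> \<le> M1" by (rule exp_small_bounded[OF exp_small_delta])
  obtain M2 where M2: "0 \<le> M2" "\<forall>n. \<bar>moment2_excess n\<bar> \<le> M2"
    by (rule exp_small_bounded[OF exp_small_moment2_excess])
  define M where "M = max M1 M2"
  have M: "0 \<le> M" and d: "\<bar>delta n\<bar> \<le> M" and e: "\<bar>moment2_excess n\<bar> \<le> M" for n
    using M1 M2 by (auto simp: M_def intro: order.trans le_max_iff_disj[THEN iffD2])
  obtain C where C: "0 \<le> C" and C': "\<forall>t a b. \<bar>t\<bar> \<le> 1 \<longrightarrow> \<bar>a\<bar> \<le> M \<longrightarrow> \<bar>b\<bar> \<le> M \<longrightarrow>
    cmod (exp (\<i> * of_real (t * a) - of_real (t\<^sup>2 / 2 * (b - a\<^sup>2))) -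
      (1 + \<i> * of_real (t * a) - of_real (t\<^sup>2 / 2 * b))) \<le> C * \<bar>t\<bar> ^ 3"
    by (rule exp_second_order)
  define Q where "Q = 1 + 2 * M + C"
  define C2 where "C2 = C * Q + Q * C + 2 * M\<^sup>2"
  show ?thesis
  proof (rule that[of "C + C2"], safe)
    show "0 \<le> C + C2" using C M by (simp add: C2_def Q_def)
  next
    fix t :: real and n :: nat assume n: "n \<ge> 2" and t: "\<bar>t\<bar> \<le> 1"
    \<comment> \<open>\<open>lin\<close> is the second-order Taylor polynomial of
      \<open>gauss_factor\<close>; \<open>quad i j\<close> below is the product
      \<open>lin i * lin j\<close> without its terms of order three and four.\<close>
    define lin where "lin n = 1 + \<i> * of_real (t * delta n) - complex_of_real (t\<^sup>2 / 2 * moment2_excess n)" for n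
    define quad where "quad i j = 1 + \<i> * of_real (t * (delta i + delta j)) -
      complex_of_real (t\<^sup>2 / 2 * (moment2_excess i + moment2_excess j + 2 * delta i * delta j))" for i j
    let ?E = "gauss_factor t"
    have t3: "\<bar>t\<bar> ^ 3 \<le> 1" using t by (simp add: power_le_one)
    have t4: "t ^ 4 \<le> \<bar>t\<bar> ^ 3" using power_decreasing[of 3 4 "\<bar>t\<bar>"] t by simp
    have t2: "t\<^sup>2 \<le> 1" using t abs_square_le_1 by auto
    have 1: "cmod (?E i - lin i) \<le> C * \<bar>t\<bar> ^ 3" for i
      using C' t d e unfolding gauss_factor_def lin_def by blast
    have lin: "cmod (lin i) \<le> 1 + 2 * M" for i
    proof -
      have "cmod (lin i) \<le> 1 + \<bar>t\<bar> * \<bar>delta i\<bar> + t\<^sup>2 / 2 * \<bar>moment2_excess i\<bar>"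
        unfolding lin_def
        using norm_triangle_ineq[of 1 "\<i> * of_real (t * delta i)"]
          norm_triangle_ineq4[of "1 + \<i> * of_real (t * delta i)" "complex_of_real (t\<^sup>2 / 2 * moment2_excess i)"]
        by (simp only: norm_mult norm_ii norm_one norm_of_real abs_mult) simp
      also have "\<dots> \<le> 1 + 1 * M + 1 * M"
        using t t2 d e M by (intro add_mono mult_mono) auto
      finally show ?thesis by simp
    qed
    have linQ: "cmod (lin i) \<le> Q" for i using lin[of i] C by (simp add: Q_def)
    have EQ: "cmod (?E i) \<le> Q" for i
    proof -
      have "cmod (?E i) \<le> cmod (lin i) + cmod (?E i - lin i)" by norm
      also have "\<dots> \<le> (1 + 2 * M) + C * 1"
        using lin[of i] order.trans[OF 1 mult_left_mono[OF t3 C]] by (intro add_mono) auto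
      finally show ?thesis by (simp add: Q_def)
    qed
    have 2: "cmod (?E i * ?E j - quad i j) \<le> C2 * \<bar>t\<bar> ^ 3" for i j
    proof -
      have "?E i * ?E j - quad i j = (?E i - lin i) * ?E j + lin i * (?E j - lin j) + (lin i * lin j - quad i j)"
        by (simp add: algebra_simps)
      also have "cmod \<dots> \<le> C * \<bar>t\<bar> ^ 3 * Q + Q * (C * \<bar>t\<bar> ^ 3) + 2 * M\<^sup>2 * \<bar>t\<bar> ^ 3"
      proof (intro order.trans[OF norm_triangle_ineq] add_mono)
        show "cmod ((?E i - lin i) * ?E j) \<le> C * \<bar>t\<bar> ^ 3 * Q"
          unfolding norm_mult using C by (intro mult_mono 1 EQ) auto
        show "cmod (lin i * (?E j - lin j)) \<le> Q * (C * \<bar>t\<bar> ^ 3)"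
          unfolding norm_mult using C M by (intro mult_mono 1 linQ) (auto simp: Q_def)
        have "lin i * lin j - quad i j = of_real (t ^ 4 / 4 * (moment2_excess i * moment2_excess j)) -
            \<i> * of_real (t ^ 3 / 2 * (delta i * moment2_excess j + moment2_excess i * delta j))"
          by (simp add: lin_def quad_def complex_eq_iff power2_eq_square eval_nat_numeral field_simps)
        also have "cmod \<dots> \<le> t ^ 4 / 4 * \<bar>moment2_excess i * moment2_excess j\<bar> +
            \<bar>t\<bar> ^ 3 / 2 * \<bar>delta i * moment2_excess j + moment2_excess i * delta j\<bar>"
          by (rule order.trans[OF norm_triangle_ineq4])
            (simp add: norm_mult norm_divide norm_power power_abs abs_mult del: of_real_add of_real_mult of_real_divide of_real_power)
        also have "\<dots> \<le> \<bar>t\<bar> ^ 3 * M\<^sup>2 + \<bar>t\<bar> ^ 3 / 2 * (2 * M\<^sup>2)"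
        proof (intro add_mono mult_mono)
          have "0 \<le> t ^ 4" by simp
          with t4 show "t ^ 4 / 4 \<le> \<bar>t\<bar> ^ 3" by linarith
          have p: "\<bar>x * y\<bar> \<le> M\<^sup>2" if "\<bar>x\<bar> \<le> M" "\<bar>y\<bar> \<le> M" for x y
            unfolding abs_mult power2_eq_square using that M by (intro mult_mono) auto
          show "\<bar>moment2_excess i * moment2_excess j\<bar> \<le> M\<^sup>2" by (intro p d e)
          show "\<bar>delta i * moment2_excess j + moment2_excess i * delta j\<bar> \<le> 2 * M\<^sup>2"
            using p[OF d[of i] e[of j]] p[OF e[of i] d[of j]] by linarith
        qed auto
        also have "\<dots> = 2 * M\<^sup>2 * \<bar>t\<bar> ^ 3" by simp
        finally show "cmod (lin i * lin j - quad i j) \<le> 2 * M\<^sup>2 * \<bar>t\<bar> ^ 3" .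
      qed
      also have "\<dots> = C2 * \<bar>t\<bar> ^ 3" by (simp add: C2_def algebra_simps)
      finally show ?thesis .
    qed
    \<comment> \<open>Averaging \<open>quad\<close> reproduces the right-hand sides of
      \<open>delta_rec\<close> and \<open>moment2_excess_rec\<close> up to the tolls.\<close>
    have "split_avg n quad = 1 + \<i> * of_real (t * (2 / (real n - 1) * (\<Sum>i=1..<n. delta i))) -
        complex_of_real (t\<^sup>2 / 2 * (2 / (real n - 1) * (\<Sum>i=1..<n. moment2_excess i) + delta_conv n))"
    proof -
      have flip: "(\<Sum>i=1..<n. f i + f (n - i)) = 2 * (\<Sum>i=1..<n. f i :: real)" for f
        using sum_flip[of f n] by (simp add: sum.distrib)
      have "Re (split_avg n quad) = 1 - t\<^sup>2 / 2 * (2 / (real n - 1) * (\<Sum>i=1..<n. moment2_excess i) + delta_conv n)"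
      proof -
        have "Re (split_avg n quad) = (\<Sum>i=1..<n. 1 - t\<^sup>2 / 2 * ((moment2_excess i + moment2_excess (n - i)) +
            2 * (delta i * delta (n - i)))) / (real n - 1)"
          by (simp add: split_avg_def quad_def mult.assoc)
        also have "\<dots> = ((real n - 1) - t\<^sup>2 / 2 * (2 * (\<Sum>i=1..<n. moment2_excess i) +
            2 * (\<Sum>i=1..<n. delta i * delta (n - i)))) / (real n - 1)"
          using n by (simp only: sum_subtractf sum_distrib_left[symmetric] sum.distrib[of "\<lambda>i. moment2_excess i + moment2_excess (n - i)"] flip)
            (simp add: of_nat_diff)
        also have "\<dots> = 1 - t\<^sup>2 / 2 * (2 / (real n - 1) * (\<Sum>i=1..<n. moment2_excess i) + delta_conv n)"
        proof -
          have "(m - t\<^sup>2 / 2 * (2 * x + 2 * y)) / m = 1 - t\<^sup>2 / 2 * (2 / m * x + 2 / m * y)" if "m \<noteq> 0" for m x y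
            using that by (simp add: field_simps)
          then show ?thesis unfolding delta_conv_def using n by simp
        qed
        finally show ?thesis .
      qed
      moreover have "Im (split_avg n quad) = t * (2 / (real n - 1) * (\<Sum>i=1..<n. delta i))"
      proof -
        have "Im (split_avg n quad) = (\<Sum>i=1..<n. t * (delta i + delta (n - i))) / (real n - 1)"
          by (simp add: split_avg_def quad_def)
        also have "\<dots> = t * (2 / (real n - 1) * (\<Sum>i=1..<n. delta i))"
          unfolding sum_distrib_left[symmetric] flip by simp
        finally show ?thesis .
      qed
      ultimately show ?thesis by (simp add: complex_eq_iff)
    qed
    then have 3: "lin n - split_avg n quad = toll_term t n"
      using delta_rec[OF n] moment2_excess_rec[OF n]
      by (simp add: lin_def toll_term_def complex_eq_iff algebra_simps)
    have "?E n - split_avg n (\<lambda>i j. ?E i * ?E j) - toll_term t n =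
        (?E n - lin n) - split_avg n (\<lambda>i j. ?E i * ?E j - quad i j)"
      unfolding 3[symmetric] split_avg_diff[symmetric] by simp
    also have "cmod \<dots> \<le> C * \<bar>t\<bar> ^ 3 + C2 * \<bar>t\<bar> ^ 3"
      by (rule order.trans[OF norm_triangle_ineq4 add_mono[OF 1 split_avg_bound[OF n 2]]])
    finally show "cmod (?E n - split_avg n (\<lambda>i j. ?E i * ?E j) - toll_term t n) \<le> (C + C2) * \<bar>t\<bar> ^ 3"
      by (simp add: distrib_right)
  qed
qed

lemma exp_gauss_exponent:
  "exp (gauss_exponent t n) = of_real (exp (- variance_rate * t\<^sup>2 / 2) ^ n) * gauss_factor t n"
proof -
  have "gauss_exponent t n = of_real (real n * (- variance_rate * t\<^sup>2 / 2)) +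
      (\<i> * of_real (t * delta n) - of_real (t\<^sup>2 / 2 * (moment2_excess n - (delta n)\<^sup>2)))"
    by (simp add: gauss_exponent_def moment2_excess_def complex_eq_iff field_simps)
  then show ?thesis
    by (simp only: exp_add gauss_factor_def exp_of_real exp_of_nat_mult[symmetric])
qed

text \<open>The geometric factor satisfies \<open>A ^ n = A ^ i * A ^ (n - i)\<close> and can be
  pulled out of the average. The toll term then carries \<open>A ^ n\<close> in place of 1; since
  \<open>1 - A ^ n\<close> is of order \<open>n * t\<^sup>2\<close> and the toll term is
  \<open>\<bar>t\<bar>\<close> times an exponentially small quantity, this again costs only a cubic
  error.\<close>

lemma gauss_split:
  obtains C where "0 \<le> C" "\<forall>t n. n \<ge> 2 \<longrightarrow> \<bar>t\<bar> \<le> 1 \<longrightarrow>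
    cmod (exp (gauss_exponent t n) - split_avg n (\<lambda>i j. exp (gauss_exponent t i) * exp (gauss_exponent t j)) - toll_term t n)
      \<le> C * \<bar>t\<bar> ^ 3"
proof -
  obtain C where C: "0 \<le> C" and C': "\<forall>t n. n \<ge> 2 \<longrightarrow> \<bar>t\<bar> \<le> 1 \<longrightarrow>
    cmod (gauss_factor t n - split_avg n (\<lambda>i j. gauss_factor t i * gauss_factor t j) - toll_term t n) \<le> C * \<bar>t\<bar> ^ 3"
    by (rule gauss_factor_split)
  obtain K where K: "0 \<le> K" "\<forall>n. \<bar>real n * toll_mean n\<bar> \<le> K"
    by (rule exp_small_bounded[OF exp_small_of_nat_mult[OF exp_small_toll_mean]])
  obtain K' where K': "0 \<le> K'" "\<forall>n. \<bar>real n * (real n * toll_mean n)\<bar> \<le> K'"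
    by (rule exp_small_bounded[OF exp_small_of_nat_mult[OF exp_small_of_nat_mult[OF exp_small_toll_mean]]])
  define D where "D = variance_rate * (K + 2 * (1 + nu) * K')"
  show ?thesis
  proof (rule that[of "C + D"], safe)
    show "0 \<le> C + D" using C K K' nu_nonneg variance_rate_pos by (simp add: D_def)
  next
    fix t :: real and n :: nat assume n: "n \<ge> 2" and t: "\<bar>t\<bar> \<le> 1"
    define A where "A = exp (- variance_rate * t\<^sup>2 / 2)"
    define X where "X = gauss_factor t n - split_avg n (\<lambda>i j. gauss_factor t i * gauss_factor t j)"
    have A: "0 \<le> A" "A \<le> 1" using variance_rate_pos by (auto simp: A_def)
    then have An: "0 \<le> A ^ n" "A ^ n \<le> 1" by (auto simp: power_le_one)
    have t2: "t\<^sup>2 \<le> \<bar>t\<bar>" using mult_left_le[of "\<bar>t\<bar>" "\<bar>t\<bar>"] t by (simp add: power2_eq_square)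
    have g: "exp (gauss_exponent t m) = of_real (A ^ m) * gauss_factor t m" for m
      by (simp only: exp_gauss_exponent A_def)
    have "split_avg n (\<lambda>i j. exp (gauss_exponent t i) * exp (gauss_exponent t j)) =
        of_real (A ^ n) * split_avg n (\<lambda>i j. gauss_factor t i * gauss_factor t j)"
    proof -
      have "exp (gauss_exponent t i) * exp (gauss_exponent t (n - i)) =
          of_real (A ^ n) * (gauss_factor t i * gauss_factor t (n - i))" if "i \<in> {1..<n}" for i
      proof -
        have "A ^ n = A ^ i * A ^ (n - i)" using that by (simp flip: power_add)
        then show ?thesis unfolding g by simp
      qed
      then show ?thesis by (simp add: split_avg_def sum_distrib_left)
    qed
    then have "exp (gauss_exponent t n) - split_avg n (\<lambda>i j. exp (gauss_exponent t i) * exp (gauss_exponent t j)) - toll_term t n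
        = of_real (A ^ n) * (X - toll_term t n) - of_real (1 - A ^ n) * toll_term t n"
      by (simp add: g X_def algebra_simps)
    also have "cmod \<dots> \<le> C * \<bar>t\<bar> ^ 3 + D * \<bar>t\<bar> ^ 3"
    proof (intro order.trans[OF norm_triangle_ineq4] add_mono)
      have "cmod (of_real (A ^ n) * (X - toll_term t n)) \<le> 1 * (C * \<bar>t\<bar> ^ 3)"
        unfolding norm_mult norm_of_real X_def using C' n t An by (intro mult_mono) auto
      then show "cmod (of_real (A ^ n) * (X - toll_term t n)) \<le> C * \<bar>t\<bar> ^ 3" by simp
      have "1 - A ^ n \<le> real n * (variance_rate * t\<^sup>2 / 2)"
        using exp_ge_add_one_self[of "real n * (- variance_rate * t\<^sup>2 / 2)"]
        by (simp add: A_def exp_of_nat_mult[symmetric])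
      moreover have "0 \<le> real n * (variance_rate * t\<^sup>2)" using variance_rate_pos by simp
      ultimately have 1: "1 - A ^ n \<le> real n * variance_rate * t\<^sup>2" by (simp add: mult.assoc)
      have "cmod (toll_term t n) \<le> \<bar>t\<bar> * \<bar>toll_mean n\<bar> + t\<^sup>2 / 2 * \<bar>moment2_toll n\<bar>"
        unfolding toll_term_def by (rule order.trans[OF norm_triangle_ineq4]) (simp add: norm_mult abs_mult norm_power)
      also have "\<dots> \<le> \<bar>t\<bar> * toll_mean n + \<bar>t\<bar> * (2 * (1 + nu) * (real n * toll_mean n))"
        using abs_moment2_toll_le[OF n] t2 toll_mean_nonneg[of n] by (intro add_mono mult_mono) auto
      finally have 2: "cmod (toll_term t n) \<le> \<bar>t\<bar> * (toll_mean n + 2 * (1 + nu) * (real n * toll_mean n))"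
        by (simp add: distrib_left)
      have "cmod (of_real (1 - A ^ n) * toll_term t n) \<le>
          (real n * variance_rate * t\<^sup>2) * (\<bar>t\<bar> * (toll_mean n + 2 * (1 + nu) * (real n * toll_mean n)))"
        unfolding norm_mult norm_of_real using 1 2 An variance_rate_pos by (intro mult_mono) auto
      also have "\<dots> = variance_rate * \<bar>t\<bar> ^ 3 * (real n * toll_mean n + 2 * (1 + nu) * (real n * (real n * toll_mean n)))"
        unfolding abs_power3 by (simp add: algebra_simps)
      also have "\<dots> \<le> variance_rate * \<bar>t\<bar> ^ 3 * (K + 2 * (1 + nu) * K')"
        using variance_rate_pos nu_nonneg K(2)[rule_format, of n] K'(2)[rule_format, of n]
        by (intro mult_left_mono add_mono) auto
      finally show "cmod (of_real (1 - A ^ n) * toll_term t n) \<le> D * \<bar>t\<bar> ^ 3"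
        by (simp add: D_def mult_ac)
    qed
    finally show "cmod (exp (gauss_exponent t n) - split_avg n (\<lambda>i j. exp (gauss_exponent t i) * exp (gauss_exponent t j)) - toll_term t n)
      \<le> (C + D) * \<bar>t\<bar> ^ 3" by (simp add: distrib_right)
  qed
qed

section \<open>Comparison of the two characteristic functions\<close>

lemma cmod_char_fun_le: "n \<ge> 1 \<Longrightarrow> cmod (char_fun t n) \<le> 1"
  unfolding char_fun_def by (rule norm_bst_mean_bound) auto

lemma delta_square_le: "n \<ge> 1 \<Longrightarrow> (delta n)\<^sup>2 \<le> moment2 n"
proof -
  assume n: "n \<ge> 1"
  have "0 \<le> bst_mean n (\<lambda>T. (excess T - delta n)\<^sup>2)" by (rule bst_mean_nonneg) simp
  also have "(\<lambda>T. (excess T - delta n)\<^sup>2) = (\<lambda>T. (excess T)\<^sup>2 - 2 * delta n * excess T + (delta n)\<^sup>2)"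
    by (simp add: fun_eq_iff power2_diff algebra_simps)
  also have "bst_mean n \<dots> = moment2 n - (delta n)\<^sup>2"
    using n by (simp add: bst_mean_add bst_mean_diff bst_mean_mult_left bst_mean_const moment2_def
        delta_def[symmetric] power2_eq_square)
  finally show ?thesis by simp
qed

text \<open>The real part of the exponent is \<open>- t\<^sup>2 / 2\<close> times a variance, which
  is nonnegative.\<close>

lemma cmod_exp_gauss_le: "n \<ge> 1 \<Longrightarrow> cmod (exp (gauss_exponent t n)) \<le> 1"
  using delta_square_le[of n] by (simp add: gauss_exponent_def)

text \<open>
  Both functions are bounded by one, so that the error made at a node of size \<open>n\<close> is at most the sum
  of the errors in its two subtrees, plus the third-order defect of the recurrence.
\<close>

lemma char_fun_gauss_approx:
  obtains C where "0 \<le> C" "\<forall>t n. n \<ge> 1 \<longrightarrow> \<bar>t\<bar> \<le> 1 \<longrightarrow>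
    cmod (char_fun t n - exp (gauss_exponent t n)) \<le> C * \<bar>t\<bar> ^ 3 * (real n - 1)"
proof -
  obtain C1 where C1: "0 \<le> C1" and C1': "\<forall>t n. n \<ge> 2 \<longrightarrow>
    cmod (char_fun t n - split_avg n (\<lambda>i j. char_fun t i * char_fun t j) - toll_term t n) \<le> C1 * \<bar>t\<bar> ^ 3"
    by (rule char_fun_split)
  obtain C2 where C2: "0 \<le> C2" and C2': "\<forall>t n. n \<ge> 2 \<longrightarrow> \<bar>t\<bar> \<le> 1 \<longrightarrow>
    cmod (exp (gauss_exponent t n) - split_avg n (\<lambda>i j. exp (gauss_exponent t i) * exp (gauss_exponent t j)) - toll_term t n)
      \<le> C2 * \<bar>t\<bar> ^ 3"
    by (rule gauss_split)
  have "cmod (char_fun t n - exp (gauss_exponent t n)) \<le> (C1 + C2) * \<bar>t\<bar> ^ 3 * (real n - 1)"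
    if "n \<ge> 1" and t: "\<bar>t\<bar> \<le> 1" for t n
    using \<open>n \<ge> 1\<close>
  proof (induction n rule: less_induct)
    case (less n)
    let ?f = "char_fun t" and ?g = "\<lambda>n. exp (gauss_exponent t n)"
    show ?case
    proof (cases "n = 1")
      case True
      \<comment> \<open>There is only one tree, so the normal law is degenerate and the error starts
        at zero; hence the factor \<open>n - 1\<close>.\<close>
      have "?f 1 = ?g 1"
        unfolding char_fun_def gauss_exponent_def moment2_def delta_def bst_mean_1
        by (simp add: cis_conv_exp)
      then show ?thesis using True by simp
    next
      case False
      with less.prems have n: "n \<ge> 2" by simp
      \<comment> \<open>The subtrees contribute \<open>i - 1\<close> and \<open>j - 1\<close>, in
        total \<open>n - 2\<close>; the defect at the root supplies the missing unit.\<close>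
      have "cmod (?f i * ?f j - ?g i * ?g j) \<le> (C1 + C2) * \<bar>t\<bar> ^ 3 * (real n - 2)"
        if ij: "1 \<le> i" "1 \<le> j" "i + j = n" for i j
      proof -
        have "?f i * ?f j - ?g i * ?g j = ?f i * (?f j - ?g j) + (?f i - ?g i) * ?g j"
          by (simp add: algebra_simps)
        also have "cmod \<dots> \<le> 1 * ((C1 + C2) * \<bar>t\<bar> ^ 3 * (real j - 1)) + (C1 + C2) * \<bar>t\<bar> ^ 3 * (real i - 1) * 1"
          using ij C1 C2
          by (intro order.trans[OF norm_triangle_ineq] add_mono order.trans[OF norm_mult_ineq] mult_mono
              cmod_char_fun_le cmod_exp_gauss_le less.IH) auto
        also have "\<dots> = (C1 + C2) * \<bar>t\<bar> ^ 3 * (real n - 2)"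
          using ij(3) by (simp add: algebra_simps flip: ij(3))
        finally show ?thesis .
      qed
      then have *: "cmod (split_avg n (\<lambda>i j. ?f i * ?f j - ?g i * ?g j)) \<le> (C1 + C2) * \<bar>t\<bar> ^ 3 * (real n - 2)"
        by (rule split_avg_bound[OF n])
      have "cmod (?f n - ?g n) \<le> cmod (?f n - split_avg n (\<lambda>i j. ?f i * ?f j) - toll_term t n) +
          cmod (?g n - split_avg n (\<lambda>i j. ?g i * ?g j) - toll_term t n) +
          cmod (split_avg n (\<lambda>i j. ?f i * ?f j - ?g i * ?g j))"
      proof -
        \<comment> \<open>Both recurrences have the same toll term \<open>c\<close>, which therefore
          cancels.\<close>
        have "cmod (a - b) \<le> cmod (a - a' - c) + cmod (b - b' - c) + cmod (a' - b')" for a b a' b' c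
          using norm_triangle_ineq[of "(a - a' - c) - (b - b' - c)" "a' - b'"]
            norm_triangle_ineq4[of "a - a' - c" "b - b' - c"] by simp
        then show ?thesis unfolding split_avg_diff[symmetric] .
      qed
      also have "\<dots> \<le> C1 * \<bar>t\<bar> ^ 3 + C2 * \<bar>t\<bar> ^ 3 + (C1 + C2) * \<bar>t\<bar> ^ 3 * (real n - 2)"
        using C1' C2' n t * by (intro add_mono) auto
      also have "\<dots> = (C1 + C2) * \<bar>t\<bar> ^ 3 * (real n - 1)" by (simp add: algebra_simps)
      finally show ?thesis .
    qed
  qed
  then show ?thesis using C1 C2 by (intro that[of "C1 + C2"]) auto
qed

lemma char_fun_limit:
  defines "\<sigma> \<equiv> sqrt variance_rate"
  shows "(\<lambda>n. char_fun (s / (\<sigma> * sqrt (real n))) n) \<longlonglongrightarrow> of_real (exp (- s\<^sup>2 / 2))"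
proof -
  have \<sigma>: "0 < \<sigma>" "\<sigma>\<^sup>2 = variance_rate" using variance_rate_pos by (auto simp: \<sigma>_def)
  define \<tau> where "\<tau> n = s / (\<sigma> * sqrt (real n))" for n
  have \<tau>: "\<tau> \<longlonglongrightarrow> 0"
    unfolding \<tau>_def using \<sigma> by real_asymp
  have \<tau>2: "(\<tau> n)\<^sup>2 * real n = s\<^sup>2 / variance_rate" if "n \<ge> 1" for n
    using that \<sigma> by (simp add: \<tau>_def power_divide power_mult_distrib)
  obtain C where C: "0 \<le> C" "\<forall>t n. n \<ge> 1 \<longrightarrow> \<bar>t\<bar> \<le> 1 \<longrightarrow>
    cmod (char_fun t n - exp (gauss_exponent t n)) \<le> C * \<bar>t\<bar> ^ 3 * (real n - 1)"
    by (rule char_fun_gauss_approx)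
  have "eventually (\<lambda>n. \<bar>\<tau> n\<bar> < 1) sequentially"
    using tendsto_rabs_zero[OF \<tau>] by (rule order_tendstoD) simp
  then have "eventually (\<lambda>n. cmod (char_fun (\<tau> n) n - exp (gauss_exponent (\<tau> n) n)) \<le>
      C * (s\<^sup>2 / variance_rate) * \<bar>\<tau> n\<bar>) sequentially"
    using eventually_ge_at_top[of 1]
  proof eventually_elim
    case (elim n)
    have "cmod (char_fun (\<tau> n) n - exp (gauss_exponent (\<tau> n) n)) \<le> C * \<bar>\<tau> n\<bar> ^ 3 * (real n - 1)"
      using elim by (intro C(2)[rule_format]) auto
    also have "\<dots> \<le> C * \<bar>\<tau> n\<bar> ^ 3 * real n"
      using C by (intro mult_left_mono) auto
    also have "\<dots> = C * ((\<tau> n)\<^sup>2 * real n) * \<bar>\<tau> n\<bar>"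
      unfolding abs_power3 by (simp only: mult_ac)
    finally show ?case unfolding \<tau>2[OF elim(2)] .
  qed
  moreover have "(\<lambda>n. C * (s\<^sup>2 / variance_rate) * \<bar>\<tau> n\<bar>) \<longlonglongrightarrow> 0"
    by (intro tendsto_mult_right_zero tendsto_rabs_zero \<tau>)
  ultimately have diff: "(\<lambda>n. char_fun (\<tau> n) n - exp (gauss_exponent (\<tau> n) n)) \<longlonglongrightarrow> 0"
    by (rule Lim_null_comparison)
  \<comment> \<open>The linear part of the variance contributes exactly \<open>s\<^sup>2 / 2\<close>
    by \<open>\<tau>2\<close>; the remaining corrections tend to zero.\<close>
  have "(\<lambda>n. \<i> * of_real (\<tau> n * delta n) -
      of_real (s\<^sup>2 / 2 + (\<tau> n)\<^sup>2 / 2 * (moment2_excess n - (delta n)\<^sup>2))) \<longlonglongrightarrow> \<i> * of_real (0 * 0) - complex_of_real (s\<^sup>2 / 2 + 0\<^sup>2 / 2 * (0 - 0\<^sup>2))"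
    by (intro tendsto_intros \<tau> exp_small_tendsto_0[OF exp_small_delta] exp_small_tendsto_0[OF exp_small_moment2_excess]) auto
  then have "(\<lambda>n. \<i> * of_real (\<tau> n * delta n) -
      of_real (s\<^sup>2 / 2 + (\<tau> n)\<^sup>2 / 2 * (moment2_excess n - (delta n)\<^sup>2))) \<longlonglongrightarrow> of_real (- s\<^sup>2 / 2)"
    by simp
  then have "(\<lambda>n. gauss_exponent (\<tau> n) n) \<longlonglongrightarrow> of_real (- s\<^sup>2 / 2)"
  proof (rule Lim_transform_eventually)
    show "\<forall>\<^sub>F n in sequentially. \<i> * of_real (\<tau> n * delta n) -
      of_real (s\<^sup>2 / 2 + (\<tau> n)\<^sup>2 / 2 * (moment2_excess n - (delta n)\<^sup>2)) = gauss_exponent (\<tau> n) n"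
      using eventually_ge_at_top[of 1]
    proof eventually_elim
      case (elim n)
      have "(\<tau> n)\<^sup>2 / 2 * (moment2 n - (delta n)\<^sup>2) =
          variance_rate * ((\<tau> n)\<^sup>2 * real n) / 2 + (\<tau> n)\<^sup>2 / 2 * (moment2_excess n - (delta n)\<^sup>2)"
        by (simp add: moment2_excess_def field_simps)
      also have "variance_rate * ((\<tau> n)\<^sup>2 * real n) / 2 = s\<^sup>2 / 2"
        unfolding \<tau>2[OF elim] using variance_rate_pos by simp
      finally show ?case by (simp only: gauss_exponent_def)
    qed
  qed
  then have "(\<lambda>n. exp (gauss_exponent (\<tau> n) n)) \<longlonglongrightarrow> exp (of_real (- s\<^sup>2 / 2))"
    by (rule tendsto_exp)
  from tendsto_add[OF diff this] show ?thesis
    by (simp add: \<tau>_def exp_of_real[symmetric])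
qed

section \<open>The central limit theorem\<close>

definition normalized_excess_distr :: "nat \<Rightarrow> real measure" where
  "normalized_excess_distr n =
     distr (measure_pmf (random_bst n)) borel (\<lambda>T. excess T / (sqrt variance_rate * sqrt (real n)))"

lemma real_distribution_normalized_excess: "real_distribution (normalized_excess_distr n)"
  unfolding normalized_excess_distr_def
  by (intro prob_space.real_distribution_distr measure_pmf.prob_space_axioms) simp

lemma char_normalized_excess_distr:
  assumes "n \<ge> 1"
  shows "char (normalized_excess_distr n) s = char_fun (s / (sqrt variance_rate * sqrt (real n))) n"
proof -
  have "char (normalized_excess_distr n) s =
      measure_pmf.expectation (random_bst n) (\<lambda>T. iexp (s * (excess T / (sqrt variance_rate * sqrt (real n)))))"
    unfolding char_def normalized_excess_distr_def by (subst integral_distr) auto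
  also have "\<dots> = bst_mean n (\<lambda>T. iexp (s * (excess T / (sqrt variance_rate * sqrt (real n)))))"
    using assms by (rule integral_random_bst)
  also have "\<dots> = char_fun (s / (sqrt variance_rate * sqrt (real n))) n"
    unfolding char_fun_def by (intro bst_mean_cong) (simp add: cis_conv_exp)
  finally show ?thesis .
qed

lemma weak_conv_normalized_excess: "weak_conv_m normalized_excess_distr std_normal_distribution"
proof (rule levy_continuity)
  fix s
  have "\<forall>\<^sub>F n in sequentially. char_fun (s / (sqrt variance_rate * sqrt (real n))) n = char (normalized_excess_distr n) s"
    using eventually_ge_at_top[of 1] by eventually_elim (simp add: char_normalized_excess_distr)
  then show "(\<lambda>n. char (normalized_excess_distr n) s) \<longlonglongrightarrow> char std_normal_distribution s"
    unfolding char_std_normal_distribution by (rule Lim_transform_eventually[OF char_fun_limit])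
qed (auto intro: real_distribution_normalized_excess real_dist_normal_dist)

lemma cdf_std_normal:
  "cdf std_normal_distribution x = 1 / sqrt (2 * pi) * (LBINT t:{..x}. exp (- t\<^sup>2 / 2))"
proof -
  have "cdf std_normal_distribution x = (LINT t|std_normal_distribution. indicator {..x} t)"
    by (simp add: cdf_def)
  also have "\<dots> = (LBINT t. std_normal_density t * indicator {..x} t)"
    by (subst integral_density) (auto simp: normal_density_nonneg)
  also have "\<dots> = (LBINT t. 1 / sqrt (2 * pi) * (indicator {..x} t *\<^sub>R exp (- t\<^sup>2 / 2)))"
    by (intro Bochner_Integration.integral_cong) (auto simp: std_normal_density_def)
  finally show ?thesis by (simp add: set_lebesgue_integral_def)
qed

text \<open>A law with a density has no atoms; weak convergence therefore gives convergence of the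
  distribution functions at every point.\<close>

lemma isCont_cdf_std_normal: "isCont (cdf std_normal_distribution) x"
proof -
  interpret real_distribution std_normal_distribution by (rule real_dist_normal_dist)
  have "emeasure std_normal_distribution {x} = (\<integral>\<^sup>+ t. std_normal_density t * indicator {x} t \<partial>lborel)"
    by (subst emeasure_density) auto
  also have "\<dots> = 0"
    by (subst nn_integral_0_iff_AE) (auto intro!: AE_I[of _ _ "{x}"] simp: indicator_def)
  finally show ?thesis by (simp add: isCont_cdf measure_def)
qed

lemma cdf_normalized_excess:
  assumes "n \<ge> 1"
  shows "cdf (normalized_excess_distr n) x = measure_pmf.prob (random_bst n)
    {t. real (card (Aut t)) \<le> 2 powr (nu * real n + sqrt variance_rate * sqrt (real n) * x)}"
proof -
  define c where "c = sqrt variance_rate * sqrt (real n)"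
  have c: "0 < c" using variance_rate_pos assms by (simp add: c_def)
  have iff: "excess t / c \<le> x \<longleftrightarrow> real (card (Aut t)) \<le> 2 powr (nu * real n + c * x)" if "size1 t = n" for t
  proof -
    have "real (card (Aut t)) = 2 powr real (nsym t)"
      by (simp add: card_Aut_eq powr_realpow)
    moreover have "excess t / c \<le> x \<longleftrightarrow> real (nsym t) \<le> nu * real n + c * x"
      using c that by (auto simp: excess_def field_simps)
    ultimately show ?thesis by simp
  qed
  have "cdf (normalized_excess_distr n) x = measure_pmf.prob (random_bst n) {t. excess t / c \<le> x}"
    unfolding cdf_def normalized_excess_distr_def c_def
    by (subst measure_distr) (auto simp: vimage_def)
  \<comment> \<open>The equivalence \<open>iff\<close> is available for trees of size
    \<open>n\<close> only, so the events are compared under the finite sum.\<close>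
  also have "\<dots> = bst_mean n (\<lambda>t. of_bool (excess t / c \<le> x))"
    using assms by (simp add: prob_random_bst)
  also have "\<dots> = bst_mean n (\<lambda>t. of_bool (real (card (Aut t)) \<le> 2 powr (nu * real n + c * x)))"
    by (intro bst_mean_cong) (simp add: iff)
  also have "\<dots> = measure_pmf.prob (random_bst n) {t. real (card (Aut t)) \<le> 2 powr (nu * real n + c * x)}"
    using assms by (simp add: prob_random_bst)
  finally show ?thesis by (simp only: c_def)
qed

theorem theorem8:
  shows "\<exists>\<nu> \<sigma>\<^sub>3 :: real. \<nu> > 0 \<and> \<sigma>\<^sub>3 > 0 \<and>
    ((\<lambda>k. iso_prob k / (real k * (2 * real k + 1) * (2 * real k - 1))) has_sum \<nu>) {1..} \<and>
    \<bar>\<nu> - 0.3795493473\<bar> \<le> 1 / 2 * (1 / 10 ^ 10) \<and>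
    (\<forall>x::real.
      (\<lambda>k. measure_pmf.prob (random_bst k)
              {t. real (card (Aut t)) \<le> 2 powr (\<nu> * real k + \<sigma>\<^sub>3 * sqrt (real k) * x)})
        \<longlonglongrightarrow> 1 / sqrt (2 * pi) * (LBINT t:{..x}. exp (- t\<^sup>2 / 2)))"
proof (intro exI conjI allI)
  have bounds: "\<bar>nu - 0.3795493473\<bar> \<le> 1 / 2 * (1 / 10 ^ 10)"
    unfolding nu_def by (rule suminf_nu_term_bounds)
  then show "\<bar>nu - 0.3795493473\<bar> \<le> 1 / 2 * (1 / 10 ^ 10)" .
  have "(0 :: real) < 0.3795493473 - 1 / 2 * (1 / 10 ^ 10)" by simp
  with bounds show "0 < nu" by linarith
  show "0 < sqrt variance_rate" using variance_rate_pos by simp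
  show "((\<lambda>k. iso_prob k / (real k * (2 * real k + 1) * (2 * real k - 1))) has_sum nu) {1..}"
    using has_sum_nu_term unfolding nu_def nu_term_def .
  fix x :: real
  have "(\<lambda>n. cdf (normalized_excess_distr n) x) \<longlonglongrightarrow> cdf std_normal_distribution x"
    using weak_conv_normalized_excess isCont_cdf_std_normal unfolding weak_conv_m_def weak_conv_def by blast
  moreover have "\<forall>\<^sub>F n in sequentially. cdf (normalized_excess_distr n) x = measure_pmf.prob (random_bst n)
      {t. real (card (Aut t)) \<le> 2 powr (nu * real n + sqrt variance_rate * sqrt (real n) * x)}"
    using eventually_ge_at_top[of 1] by eventually_elim (rule cdf_normalized_excess)
  ultimately show "(\<lambda>k. measure_pmf.prob (random_bst k)
      {t. real (card (Aut t)) \<le> 2 powr (nu * real k + sqrt variance_rate * sqrt (real k) * x)})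
        \<longlonglongrightarrow> 1 / sqrt (2 * pi) * (LBINT t:{..x}. exp (- t\<^sup>2 / 2))"
    unfolding cdf_std_normal by (rule Lim_transform_eventually)
qed

end
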